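(* Let $\Omega$ be the unit disk in $\mathbb{R}^2$. (i) Given $b\in(0,1)$ and $q_1,q_2\in F_b$, we have $$\|q_1-q_2\|_{L^\infty(\Omega)}\le\frac{(4.8765)^2}{b^4}\,\|\Lambda_{q_1}-\Lambda_{q_2}\|_{\mathcal{L}(H^{1/2}_{\#};H^{-1/2}_{\#})}.$$ (ii) Given $\gamma\in(0,1]$ and $q_1,q_2\in G_\gamma$, with $q_i(x)=\gamma\chi_{(0,b_i)}(|x|)$, $b_i\in(0,1)$, $i=1,2$, we have $$|b_1-b_2|\le\frac{15}{2\gamma b^3}\,\|\Lambda_{q_1}-\Lambda_{q_2}\|_{\mathcal{L}(H^{1/2}_{\#};H^{-1/2}_{\#})},$$ where $b=\min\{b_1,b_2\}$.
   Context: $\Omega=\{x\in\mathbb{R}^2:|x|<1\}$; $\chi_{(0,b)}$ is the characteristic function of $(0,b)$. For $b\in(0,1)$, $F_b=\{q\in L^\infty(\Omega): q(x)=\gamma\chi_{(0,b)}(|x|),\ \gamma\in[0,1]\}$. For $\gamma\in[0,1]$, $G_\gamma=\{q\in L^\infty(\Omega): q(x)=\gamma\chi_{(0,b)}(|x|),\ b\in(0,1)\}$. Functions on $\partial\Omega$ are identified with $2\pi$-periodic functions of the polar angle; $g=\sum_{n\in\mathbb{Z}}g_ne^{in\theta}$ with $g_n=\frac1{2\pi}\int_0^{2\pi}g(t)e^{-int}\,dt$. The space $H^\alpha_{\#}$ ($\alpha=\pm1/2$) has norm $\|g\|_\alpha^2=\sum_{n\in\mathbb{Z}}(1+n^2)^\alpha|g_n|^2$.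 For such $q$, the Dirichlet-to-Neumann map $\Lambda_q:H^{1/2}_{\#}\to H^{-1/2}_{\#}$ is $\Lambda_q g=\frac{\partial u}{\partial r}\big|_{r=1}$, where $u$ is the unique solution of $\Delta u+q(x)u=0$ in $\Omega$ with $u=g$ on $\partial\Omega$. $\|\cdot\|_{\mathcal{L}(H^{1/2}_{\#};H^{-1/2}_{\#})}$ is the operator norm. *)

theory Defs
  imports "HOL-Analysis.Analysis" "HOL-Probability.Essential_Supremum"
begin

type_synonym plane = "real \<times> real"

definition unit_disk :: "plane set" where
  "unit_disk = ball 0 1"

abbreviation disk_measure :: "plane measure" where
  "disk_measure \<equiv> lebesgue_on unit_disk"

abbreviation angle_measure :: "real measure" where
  "angle_measure \<equiv> lebesgue_on {0..2 * pi}"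

definition square_integrable :: "'a measure \<Rightarrow> ('a \<Rightarrow> 'b::euclidean_space) \<Rightarrow> bool" where
  "square_integrable M f \<longleftrightarrow> f \<in> borel_measurable M \<and> integrable M (\<lambda>x. (norm (f x))\<^sup>2)"


subsection \<open>Potentials\<close>

definition Linfty_norm :: "(plane \<Rightarrow> real) \<Rightarrow> ennreal" where
  "Linfty_norm q = esssup disk_measure (\<lambda>x. ennreal \<bar>q x\<bar>)"

definition Linfty :: "(plane \<Rightarrow> real) set" where
  "Linfty = {q \<in> borel_measurable disk_measure. Linfty_norm q < \<infinity>}"

text \<open>The pointwise formula for a potential is an identity between classes in L-infinity, so it
  is only required almost everywhere.\<close>

definition is_step_potential :: "real \<Rightarrow> real \<Rightarrow> (plane \<Rightarrow> real) \<Rightarrow> bool" where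
  "is_step_potential \<gamma> b q \<longleftrightarrow> (AE x in disk_measure. q x = \<gamma> * indicator {0<..<b} (norm x))"

definition F_class :: "real \<Rightarrow> (plane \<Rightarrow> real) set" where
  "F_class b = {q \<in> Linfty. \<exists>\<gamma>\<in>{0..1}. is_step_potential \<gamma> b q}"

definition G_class :: "real \<Rightarrow> (plane \<Rightarrow> real) set" where
  "G_class \<gamma> = {q \<in> Linfty. \<exists>b\<in>{0<..<1}. is_step_potential \<gamma> b q}"


subsection \<open>Periodic Sobolev spaces\<close>

definition periodic_L2 :: "(real \<Rightarrow> complex) \<Rightarrow> bool" where
  "periodic_L2 g \<longleftrightarrow> (\<forall>t. g (t + 2 * pi) = g t) \<and> square_integrable angle_measure g"

definition fourier_coeff :: "(real \<Rightarrow> complex) \<Rightarrow> int \<Rightarrow> complex" where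
  "fourier_coeff g n = (LINT t|angle_measure. g t * cis (- (of_int n * t))) / (2 * pi)"

text \<open>For negative \<open>\<alpha>\<close> the elements of the Sobolev space are periodic distributions; they are
  represented by their sequences of Fourier coefficients.\<close>

definition sobolev_seq :: "real \<Rightarrow> (int \<Rightarrow> complex) set" where
  "sobolev_seq \<alpha> = {c. (\<lambda>n. (1 + (of_int n)\<^sup>2) powr \<alpha> * (cmod (c n))\<^sup>2) summable_on UNIV}"

definition sobolev_norm :: "real \<Rightarrow> (int \<Rightarrow> complex) \<Rightarrow> real" where
  "sobolev_norm \<alpha> c = sqrt (\<Sum>\<^sub>\<infinity>n. (1 + (of_int n)\<^sup>2) powr \<alpha> * (cmod (c n))\<^sup>2)"

definition H_half :: "(real \<Rightarrow> complex) set" where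
  "H_half = {g. periodic_L2 g \<and> fourier_coeff g \<in> sobolev_seq (1/2)}"


subsection \<open>The first-order Sobolev space on the disk and the trace\<close>

definition grad :: "(plane \<Rightarrow> complex) \<Rightarrow> plane \<Rightarrow> complex \<times> complex" where
  "grad \<phi> x = (frechet_derivative \<phi> (at x) (1, 0), frechet_derivative \<phi> (at x) (0, 1))"

primrec Ck :: "nat \<Rightarrow> (plane \<Rightarrow> complex) \<Rightarrow> bool" where
  "Ck 0 \<phi> \<longleftrightarrow> continuous_on UNIV \<phi>"
| "Ck (Suc k) \<phi> \<longleftrightarrow> (\<forall>x. \<phi> differentiable (at x)) \<and>
     Ck k (\<lambda>x. fst (grad \<phi> x)) \<and> Ck k (\<lambda>x. snd (grad \<phi> x))"

definition test_function :: "(plane \<Rightarrow> complex) \<Rightarrow> bool" where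
  "test_function \<phi> \<longleftrightarrow> (\<forall>k. Ck k \<phi>) \<and> (\<exists>K. compact K \<and> K \<subseteq> unit_disk \<and> (\<forall>x. x \<notin> K \<longrightarrow> \<phi> x = 0))"

text \<open>\<open>H1 u G\<close>: the function \<open>u\<close> is in the Sobolev space of order one over the disk, with weak
  gradient \<open>G\<close>.  The gradient is unique up to null sets.\<close>

definition H1 :: "(plane \<Rightarrow> complex) \<Rightarrow> (plane \<Rightarrow> complex \<times> complex) \<Rightarrow> bool" where
  "H1 u G \<longleftrightarrow> square_integrable disk_measure u \<and> square_integrable disk_measure G \<and>
     (\<forall>\<phi>. test_function \<phi> \<longrightarrow>
        (LINT x|disk_measure. u x * fst (grad \<phi> x)) = - (LINT x|disk_measure. fst (G x) * \<phi> x) \<and>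
        (LINT x|disk_measure. u x * snd (grad \<phi> x)) = - (LINT x|disk_measure. snd (G x) * \<phi> x))"

text \<open>The trace operator is the continuous extension, with respect to the norm of the Sobolev
  space, of the restriction to the circle of functions that are continuously differentiable up to
  the boundary.\<close>

definition has_trace ::
    "(plane \<Rightarrow> complex) \<Rightarrow> (plane \<Rightarrow> complex \<times> complex) \<Rightarrow> (real \<Rightarrow> complex) \<Rightarrow> bool" where
  "has_trace u G h \<longleftrightarrow> H1 u G \<and> periodic_L2 h \<and>
     (\<exists>\<phi> :: nat \<Rightarrow> plane \<Rightarrow> complex. (\<forall>k. Ck 1 (\<phi> k)) \<and>
        (\<lambda>k. LINT x|disk_measure. (norm (\<phi> k x - u x))\<^sup>2) \<longlonglongrightarrow> 0 \<and>
        (\<lambda>k. LINT x|disk_measure. (norm (grad (\<phi> k) x - G x))\<^sup>2) \<longlonglongrightarrow> 0 \<and>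
        (\<lambda>k. LINT t|angle_measure. (norm (\<phi> k (cos t, sin t) - h t))\<^sup>2) \<longlonglongrightarrow> 0)"


subsection \<open>The Dirichlet-to-Neumann map\<close>

definition energy_form :: "(plane \<Rightarrow> real) \<Rightarrow> (plane \<Rightarrow> complex) \<Rightarrow> (plane \<Rightarrow> complex \<times> complex) \<Rightarrow>
    (plane \<Rightarrow> complex) \<Rightarrow> (plane \<Rightarrow> complex \<times> complex) \<Rightarrow> complex" where
  "energy_form q u G v H = (LINT x|disk_measure.
     fst (G x) * fst (H x) + snd (G x) * snd (H x) - of_real (q x) * u x * v x)"

text \<open>Weak solutions of \<open>\<Delta>u + q u = 0\<close> in the disk with boundary value \<open>g\<close>.\<close>

definition weak_solution :: "(plane \<Rightarrow> real) \<Rightarrow> (real \<Rightarrow> complex) \<Rightarrow>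
    (plane \<Rightarrow> complex) \<Rightarrow> (plane \<Rightarrow> complex \<times> complex) \<Rightarrow> bool" where
  "weak_solution q g u G \<longleftrightarrow> has_trace u G g \<and>
     (\<forall>v H. has_trace v H (\<lambda>t. 0) \<longrightarrow> energy_form q u G v H = 0)"

text \<open>By Green's formula the normal derivative \<open>f\<close> of a solution \<open>u\<close> satisfies
  \<open>energy_form q u G v H = \<integral> f h d\<theta>\<close> for every \<open>v\<close> with trace \<open>h\<close>.  The boundary integral is the
  duality pairing of the two Sobolev spaces, which is \<open>2 pi\<close> times the sum of
  \<open>f\<^sub>n h\<^sub>-\<^sub>n\<close> over all integers \<open>n\<close>.\<close>

definition normal_derivative :: "(plane \<Rightarrow> real) \<Rightarrow> (plane \<Rightarrow> complex) \<Rightarrow>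
    (plane \<Rightarrow> complex \<times> complex) \<Rightarrow> (int \<Rightarrow> complex) \<Rightarrow> bool" where
  "normal_derivative q u G f \<longleftrightarrow> f \<in> sobolev_seq (-1/2) \<and>
     (\<forall>v H h. has_trace v H h \<longrightarrow>
        ((\<lambda>n. f n * fourier_coeff h (- n)) has_sum (energy_form q u G v H / (2 * pi))) UNIV)"

definition DtN :: "(plane \<Rightarrow> real) \<Rightarrow> (real \<Rightarrow> complex) \<Rightarrow> int \<Rightarrow> complex" where
  "DtN q g = (THE f. \<exists>u G. weak_solution q g u G \<and> normal_derivative q u G f)"

definition DtN_op_norm :: "((real \<Rightarrow> complex) \<Rightarrow> int \<Rightarrow> complex) \<Rightarrow> ennreal" where
  "DtN_op_norm T = (SUP g\<in>{g \<in> H_half. sobolev_norm (1/2) (fourier_coeff g) \<noteq> 0}.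
     ennreal (sobolev_norm (-1/2) (T g) / sobolev_norm (1/2) (fourier_coeff g)))"

end

theory Submission
  imports Defs
begin

text \<open>Testing the operator norm on the constant function 1 suffices.  The solution with boundary value
  1 is radial, \<open>u(x) = V(|x|\<^sup>2)\<close> with \<open>4 (\<rho> V')' = - \<gamma> V\<close> for \<open>\<rho> < b\<^sup>2\<close> (a Bessel series) and
  \<open>(\<rho> V')' = 0\<close> beyond (a logarithm), and its normal derivative is a constant \<open>c\<close>.  As \<open>\<rho> V'\<close> is
  nonpositive, \<open>V\<close> decreases to its boundary value, so \<open>u \<ge> 1\<close>.  Green's formula for two
  potentials gives \<open>2 pi (c\<^sub>1 - c\<^sub>2) = - \<integral> (q\<^sub>1 - q\<^sub>2) u\<^sub>1 u\<^sub>2\<close>, so that \<open>|c\<^sub>1 - c\<^sub>2|\<close> is at least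
  \<open>|\<gamma>\<^sub>1 - \<gamma>\<^sub>2| b\<^sup>2 / 2\<close> in case (i) and \<open>\<gamma> |b\<^sub>1\<^sup>2 - b\<^sub>2\<^sup>2| / 2\<close> in case (ii); both exceed what
  is needed.\<close>


subsection \<open>The radial profile\<close>

text \<open>The profile is a function of the squared radius because |x|^2 is smooth at the origin
  and the Bessel series is entire in it. The only loss of regularity is then at the circle |x| = b,
  where the solution is C1 but its second derivatives may jump. Dividing by the boundary value of
  the unnormalised profile requires a quantitative bound: \<gamma> \<le> 1 keeps the Bessel argument
  in [0, 1/4], where the series stays within 1/3 of 1, and the logarithm can lower this by at most
  another 1/3. \<open>DtN\<close> is a definite description, so c has to be exhibited as the normal
  derivative of a weak solution and shown to be the only candidate; this is where positivity of the
  energy form on functions with zero trace enters. Traces are defined through approximation by C1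
  functions. Every integral identity is therefore proved for C1 functions and carried over by
  convergence in square mean.\<close>

definition bessel_coeff :: "nat \<Rightarrow> real" where
  "bessel_coeff k = (-1) ^ k / (fact k)\<^sup>2"

text \<open>This recurrence is the equation (x y')' = - y read off coefficient by
  coefficient.\<close>

lemma bessel_coeff_Suc: "(real (Suc k))\<^sup>2 * bessel_coeff (Suc k) = - bessel_coeff k"
  unfolding bessel_coeff_def fact_Suc of_nat_mult power_mult_distrib by (simp del: of_nat_Suc)

lemma abs_bessel_coeff_le: "\<bar>bessel_coeff k\<bar> \<le> inverse (fact k)"
proof -
  have "(1::real) \<le> fact k" by (rule fact_ge_1)
  then have "fact k * 1 \<le> fact k * (fact k :: real)" by (intro mult_left_mono) auto
  then show ?thesis by (simp add: bessel_coeff_def abs_mult power2_eq_square field_simps power_abs)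
qed

lemma summable_bes: "summable (\<lambda>k. bessel_coeff k * x ^ k)"
proof (rule summable_comparison_test)
  show "summable (\<lambda>k. \<bar>x\<bar> ^ k / fact k)"
    using summable_exp[of "\<bar>x\<bar>"] by (simp add: divide_inverse mult.commute)
  have "norm (bessel_coeff k * x ^ k) \<le> \<bar>x\<bar> ^ k / fact k" for k
    using mult_right_mono[OF abs_bessel_coeff_le[of k], of "\<bar>x\<bar> ^ k"]
    by (simp add: abs_mult power_abs field_simps)
  then show "\<exists>N. \<forall>n\<ge>N. norm (bessel_coeff n * x ^ n) \<le> \<bar>x\<bar> ^ n / fact n" by blast
qed

lemma summable_diffs_bes: "summable (\<lambda>k. diffs bessel_coeff k * x ^ k)"
  by (rule termdiff_converges_all[OF summable_bes])

text \<open>\<open>bes0 z\<close> is the Bessel function of order 0 at \<open>2 sqrt z\<close>.\<close>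

definition bes0 :: "real \<Rightarrow> real" where "bes0 x = (\<Sum>k. bessel_coeff k * x ^ k)"
definition bes1 :: "real \<Rightarrow> real" where "bes1 x = (\<Sum>k. diffs bessel_coeff k * x ^ k)"
definition bes2 :: "real \<Rightarrow> real" where "bes2 x = (\<Sum>k. diffs (diffs bessel_coeff) k * x ^ k)"

lemma DERIV_bes0: "(bes0 has_field_derivative bes1 x) (at x)"
  unfolding bes0_def bes1_def by (rule termdiffs_strong_converges_everywhere[OF summable_bes])

lemma DERIV_bes1: "(bes1 has_field_derivative bes2 x) (at x)"
  unfolding bes1_def bes2_def by (rule termdiffs_strong_converges_everywhere[OF summable_diffs_bes])

lemma isCont_bes2: "isCont bes2 x"
  unfolding bes2_def
  using termdiffs_strong_converges_everywhere[OF termdiff_converges_all[OF summable_diffs_bes], of x]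
  by (rule DERIV_isCont)

text \<open>The left side is (x y')' for y = \<open>bes0\<close>. Its k-th coefficient is (k+1)^2
  times coefficient k+1 of \<open>bes0\<close>, so the recurrence of the coefficients closes the
  argument.\<close>

lemma bes_ode: "bes1 x + x * bes2 x = - bes0 x"
proof -
  have s: "(\<lambda>k. real k * diffs bessel_coeff k * x ^ (k - Suc 0)) sums bes2 x"
    using diffs_equiv[OF termdiff_converges_all[OF summable_diffs_bes], of x]
    by (simp add: bes2_def mult.assoc)
  \<comment> \<open>The exponent is truncated subtraction: at k = 0 both sides vanish through the
    factor k, otherwise the missing power of x is restored.\<close>
  have e: "x * (real k * diffs bessel_coeff k * x ^ (k - Suc 0)) = real k * diffs bessel_coeff k * x ^ k" for k
    by (cases k) auto
  have "(\<lambda>k. real k * diffs bessel_coeff k * x ^ k) sums (x * bes2 x)"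
    using sums_mult[OF s, of x] unfolding e .
  then have "(\<lambda>k. diffs bessel_coeff k * x ^ k + real k * diffs bessel_coeff k * x ^ k) sums (bes1 x + x * bes2 x)"
    unfolding bes1_def by (intro sums_add summable_sums summable_diffs_bes)
  moreover have "diffs bessel_coeff k * x ^ k + real k * diffs bessel_coeff k * x ^ k = - (bessel_coeff k * x ^ k)" for k
  proof -
    have "diffs bessel_coeff k * x ^ k + real k * diffs bessel_coeff k * x ^ k = (real (Suc k))\<^sup>2 * bessel_coeff (Suc k) * x ^ k"
      by (simp add: diffs_def power2_eq_square algebra_simps)
    then show ?thesis by (simp only: bessel_coeff_Suc minus_mult_left)
  qed
  moreover have "(\<lambda>k. - (bessel_coeff k * x ^ k)) sums (- bes0 x)"
    unfolding bes0_def by (intro sums_minus summable_sums summable_bes)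
  ultimately show ?thesis using sums_unique2 by auto
qed

text \<open>All coefficients have modulus at most 1, so on [0, 1/4] the series is compared with the
  geometric series of ratio 1/4 and sum 4/3. The bound 1/4 on the argument is the largest value of
  \<gamma> \<rho> / 4 on the disk.\<close>

lemma bes0_bounds:
  assumes "0 \<le> z" "z \<le> 1/4"
  shows "2/3 \<le> bes0 z" "bes0 z \<le> 4/3"
proof -
  have g: "(\<lambda>k. (1/4) ^ k :: real) sums (4/3)"
    using geometric_sums[of "1/4::real"] by simp
  have b: "\<bar>bessel_coeff k * z ^ k\<bar> \<le> (1/4) ^ k" for k
  proof -
    have "inverse (fact k) \<le> (1::real)" using fact_ge_1[of k] by (simp add: field_simps)
    then have "\<bar>bessel_coeff k\<bar> \<le> 1" using abs_bessel_coeff_le[of k] by linarith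
    moreover have "z ^ k \<le> (1/4) ^ k" using assms by (intro power_mono) auto
    ultimately have "\<bar>bessel_coeff k\<bar> * z ^ k \<le> 1 * (1/4) ^ k" using assms by (intro mult_mono) auto
    then show ?thesis using assms by (simp add: abs_mult)
  qed
  have s: "(\<lambda>k. bessel_coeff k * z ^ k) sums bes0 z"
    unfolding bes0_def by (intro summable_sums summable_bes)
  show "bes0 z \<le> 4/3"
    using b by (intro sums_le[OF _ s g]) (meson abs_le_D1)
  \<comment> \<open>The minorant has the exact constant term 2 - 1 = 1 and -(1/4)^k afterwards,
    whence 2 - 4/3 = 2/3.\<close>
  have h: "(\<lambda>k. (if k = 0 then 2 else 0) - (1/4) ^ k :: real) sums (2 - 4/3)"
    using sums_single[of 0 "\<lambda>_. 2::real"] by (intro sums_diff g) auto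
  have "(if k = 0 then 2 else 0) - (1/4) ^ k \<le> bessel_coeff k * z ^ k" for k
    using b[of k] by (cases "k = 0") (simp add: bessel_coeff_def, simp add: abs_le_iff)
  then show "2/3 \<le> bes0 z" using sums_le[OF _ h s] by simp
qed

text \<open>By the differential equation z * bes1 z is the primitive of - bes0 that vanishes at 0,
  so the bounds on \<open>bes0\<close> integrate to bounds on it.\<close>

lemma bes1_bounds:
  assumes "0 \<le> z" "z \<le> 1/4"
  shows "z * bes1 z \<le> 0" "- (4/3) * z \<le> z * bes1 z"
proof -
  have d: "((\<lambda>z. z * bes1 z) has_field_derivative - bes0 x) (at x)" for x
    by (rule derivative_eq_intros DERIV_bes1 refl)+ (use bes_ode[of x] in \<open>simp add: algebra_simps\<close>)
  have "0 * bes1 0 \<ge> z * bes1 z"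
    by (rule DERIV_nonpos_imp_nonincreasing[OF assms(1)])
       (use d bes0_bounds(1) assms in \<open>meson neg_le_0_iff_le order_trans zero_le_divide_iff zero_le_numeral\<close>)
  then show "z * bes1 z \<le> 0" by simp
  have "0 * bes1 0 + (4/3) * 0 \<le> z * bes1 z + (4/3) * z"
  proof (rule DERIV_nonneg_imp_nondecreasing[OF assms(1)])
    fix x assume x: "0 \<le> x" "x \<le> z"
    have "((\<lambda>z. z * bes1 z + (4/3) * z) has_field_derivative - bes0 x + 4/3) (at x)"
      by (rule derivative_eq_intros d refl)+ simp
    then show "\<exists>y. ((\<lambda>z. z * bes1 z + 4 / 3 * z) has_real_derivative y) (at x) \<and> 0 \<le> y"
      using bes0_bounds(2)[of x] x assms by (intro exI[of _ "- bes0 x + 4/3"]) auto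
  qed
  then show "- (4/3) * z \<le> z * bes1 z" by simp
qed

text \<open>With \<rho> = |x|^2 the Laplacian of V(\<rho>) is 4 (\<rho> V')', which explains the
  factor 4 and the scaling c = \<gamma> / 4. The Bessel piece and the logarithmic piece are glued to
  a C1 function W, and V = W / W 1; the equations are linear and survive the division.
  \<open>V''\<close> is the second derivative off the junction, where its value is merely some
  bounded choice.\<close>

lemma radial_profile_exists:
  fixes \<gamma> b :: real
  assumes \<gamma>: "0 \<le> \<gamma>" "\<gamma> \<le> 1" and b: "0 < b" "b < 1"
  obtains V V' V'' :: "real \<Rightarrow> real" and K :: real where
    "\<And>x. (V has_field_derivative V' x) (at x)"
    "continuous_on UNIV V'"
    "\<And>x. x \<noteq> b\<^sup>2 \<Longrightarrow> (V' has_field_derivative V'' x) (at x)"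
    "V'' \<in> borel_measurable borel"
    "\<And>x. 0 \<le> x \<Longrightarrow> x \<le> 1 \<Longrightarrow> \<bar>V'' x\<bar> \<le> K"
    "\<And>x. x < b\<^sup>2 \<Longrightarrow> 4 * (V' x + x * V'' x) = - \<gamma> * V x"
    "\<And>x. x > b\<^sup>2 \<Longrightarrow> V' x + x * V'' x = 0"
    "V 1 = 1" "\<And>x. 0 \<le> x \<Longrightarrow> x \<le> 1 \<Longrightarrow> 1 \<le> V x"
proof -
  define c where "c = \<gamma> / 4"
  define \<beta> where "\<beta> = b\<^sup>2"
  have \<beta>: "0 < \<beta>" "\<beta> < 1" using b power_strict_mono[of b 1 2] by (auto simp: \<beta>_def)
  have c: "0 \<le> c" "c \<le> 1/4" using \<gamma> by (auto simp: c_def)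
  have c01: "0 \<le> c * x \<and> c * x \<le> 1/4" if "0 \<le> x" "x \<le> 1" for x
    using mult_mono[of c "1/4" x 1] c that by auto
  \<comment> \<open>The flux x * W' x is constant on the logarithmic side; m is its value at \<beta>
    coming from the Bessel side, so that the two derivatives agree at \<beta>.\<close>
  define m where "m = c * \<beta> * bes1 (c * \<beta>)"
  have m: "m \<le> 0" "- (4/3) * (c * \<beta>) \<le> m"
    using bes1_bounds[of "c * \<beta>"] c01[of \<beta>] \<beta> unfolding m_def by auto
  define W where "W x = (if x \<le> \<beta> then bes0 (c * x) else bes0 (c * \<beta>) + m * (ln x - ln \<beta>))" for x
  define W' where "W' x = (if x \<le> \<beta> then c * bes1 (c * x) else m / x)" for x
  define W'' where "W'' x = (if x \<le> \<beta> then c * c * bes2 (c * x) else - m / x\<^sup>2)" for x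
  have d0: "((\<lambda>x. bes0 (c * x)) has_field_derivative c * bes1 (c * x)) (at x within S)" for x S
  proof -
    have "((\<lambda>x. bes0 (c * x)) has_field_derivative bes1 (c * x) * c) (at x)"
      by (rule DERIV_chain2[OF DERIV_bes0 DERIV_cmult_Id])
    then show ?thesis by (rule has_field_derivative_at_within[THEN DERIV_cong]) (simp only: ac_simps)
  qed
  have d1: "((\<lambda>x. c * bes1 (c * x)) has_field_derivative c * c * bes2 (c * x)) (at x within S)" for x S
  proof -
    have "((\<lambda>x. bes1 (c * x)) has_field_derivative bes2 (c * x) * c) (at x)"
      by (rule DERIV_chain2[OF DERIV_bes1 DERIV_cmult_Id])
    then have "((\<lambda>x. c * bes1 (c * x)) has_field_derivative c * (bes2 (c * x) * c)) (at x)"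
      by (rule DERIV_cmult)
    then show ?thesis by (rule has_field_derivative_at_within[THEN DERIV_cong]) (simp only: ac_simps)
  qed
  have e0: "((\<lambda>x. bes0 (c * \<beta>) + m * (ln x - ln \<beta>)) has_field_derivative m / x) (at x within S)" if "x \<ge> \<beta>" for x S
  proof -
    have "((\<lambda>x. bes0 (c * \<beta>) + m * (ln x - ln \<beta>)) has_field_derivative 0 + m * (1 / x - 0)) (at x within S)"
      by (rule DERIV_add DERIV_cmult DERIV_diff DERIV_const has_field_derivative_at_within[OF DERIV_ln_divide])+
         (use that \<beta> in auto)
    then show ?thesis by simp
  qed
  have e1: "((\<lambda>x. m / x) has_field_derivative - m / x\<^sup>2) (at x within S)" if "x \<ge> \<beta>" for x S
  proof -
    have "((\<lambda>x. m / x) has_field_derivative (0 * x - m * 1) / (x * x)) (at x within S)"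
      using that \<beta> by (intro DERIV_divide DERIV_const DERIV_ident) auto
    then show ?thesis by (simp add: power2_eq_square)
  qed
  have W: "(W has_field_derivative W' x) (at x)" for x
  proof -
    \<comment> \<open>The closures of the two half-lines meet only in \<beta>, so the pieces have to
      be matched in value and derivative at that single point.\<close>
    have "((\<lambda>x. if x \<in> {..\<beta>} then bes0 (c * x) else bes0 (c * \<beta>) + m * (ln x - ln \<beta>)) has_vector_derivative
       (if x \<in> {..\<beta>} then c * bes1 (c * x) else m / x)) (at x within UNIV)"
    proof (rule has_vector_derivative_If_within_closures[where T="{\<beta><..}"])
      show "UNIV = {..\<beta>} \<union> {\<beta><..}" "x \<in> {..\<beta>} \<union> {\<beta><..}" by auto
    next
      assume "x \<in> {..\<beta>} \<union> (closure {..\<beta>} \<inter> closure {\<beta><..})"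
      show "((\<lambda>x. bes0 (c * x)) has_vector_derivative c * bes1 (c * x)) (at x within {..\<beta>} \<union> closure {..\<beta>} \<inter> closure {\<beta><..})"
        using d0 by (simp add: has_real_derivative_iff_has_vector_derivative)
    next
      assume "x \<in> {\<beta><..} \<union> (closure {..\<beta>} \<inter> closure {\<beta><..})"
      then have "x \<ge> \<beta>" by auto
      then show "((\<lambda>x. bes0 (c * \<beta>) + m * (ln x - ln \<beta>)) has_vector_derivative m / x) (at x within {\<beta><..} \<union> closure {..\<beta>} \<inter> closure {\<beta><..})"
        using e0 by (simp add: has_real_derivative_iff_has_vector_derivative)
    next
      assume "x \<in> closure {..\<beta>}" "x \<in> closure {\<beta><..}"
      then have "x = \<beta>" by auto
      then show "bes0 (c * x) = bes0 (c * \<beta>) + m * (ln x - ln \<beta>)" "c * bes1 (c * x) = m / x"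
        using \<beta> by (auto simp: m_def)
    qed
    then show ?thesis
      by (simp add: has_real_derivative_iff_has_vector_derivative W_def[abs_def] W'_def)
  qed
  have W'c: "continuous_on UNIV W'"
  proof -
    have "continuous_on ({..\<beta>} \<union> {\<beta>..}) (\<lambda>x. if x \<le> \<beta> then c * bes1 (c * x) else m / x)"
    proof (rule continuous_on_If)
      show "continuous_on {..\<beta>} (\<lambda>x. c * bes1 (c * x))" by (rule DERIV_continuous_on[OF d1])
      show "continuous_on {\<beta>..} (\<lambda>x. m / x)" by (rule DERIV_continuous_on[OF e1]) auto
    qed (use \<beta> in \<open>auto simp: m_def\<close>)
    moreover have "{..\<beta>} \<union> {\<beta>..} = UNIV" by auto
    ultimately show ?thesis by (simp add: W'_def[abs_def])
  qed
  have W'd: "(W' has_field_derivative W'' x) (at x)" if "x \<noteq> \<beta>" for x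
  proof (cases "x < \<beta>")
    case True
    show ?thesis
      by (rule has_field_derivative_transform_within_open[of "\<lambda>x. c * bes1 (c * x)" _ _ "{..<\<beta>}"])
         (use True d1 in \<open>auto simp: W'_def W''_def\<close>)
  next
    case False
    show ?thesis
      by (rule has_field_derivative_transform_within_open[of "\<lambda>x. m / x" _ _ "{\<beta><..}"])
         (use False that e1 in \<open>auto simp: W'_def W''_def\<close>)
  qed
  have cb2: "continuous_on A (\<lambda>x. c * c * bes2 (c * x))" for A
  proof -
    have "continuous_on UNIV bes2" using isCont_bes2 continuous_at_imp_continuous_on by blast
    from continuous_on_compose2[OF this, of A "\<lambda>x. c * x"]
    have "continuous_on A (\<lambda>x. bes2 (c * x))" by (simp add: continuous_on_mult_left)
    then show ?thesis by (rule continuous_on_mult_left)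
  qed
  have W''m: "W'' \<in> borel_measurable borel"
    unfolding W''_def[abs_def]
    using borel_measurable_continuous_onI[OF cb2[of UNIV]] by measurable
  have "bounded ((\<lambda>x. c * c * bes2 (c * x)) ` {0..1})"
    by (intro compact_imp_bounded compact_continuous_image cb2) auto
  then obtain K0 where K0: "\<And>x. x \<in> {0..1} \<Longrightarrow> \<bar>c * c * bes2 (c * x)\<bar> \<le> K0"
    unfolding bounded_iff by (metis imageI real_norm_def)
  have W''b: "\<bar>W'' x\<bar> \<le> max K0 (\<bar>m\<bar> / \<beta>\<^sup>2)" if "0 \<le> x" "x \<le> 1" for x
  proof (cases "x \<le> \<beta>")
    case True
    then show ?thesis using K0[of x] that by (simp add: W''_def)
  next
    case False
    then have "\<bar>m\<bar> / x\<^sup>2 \<le> \<bar>m\<bar> / \<beta>\<^sup>2" using \<beta> by (intro divide_left_mono power_mono) auto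
    then show ?thesis using False by (simp add: W''_def)
  qed
  have ode1: "4 * (W' x + x * W'' x) = - \<gamma> * W x" if "x < \<beta>" for x
  proof -
    have "W' x + x * W'' x = c * (bes1 (c * x) + c * x * bes2 (c * x))"
      using that by (simp add: W'_def W''_def algebra_simps)
    then show ?thesis unfolding bes_ode using that by (simp add: W_def c_def)
  qed
  have ode2: "W' x + x * W'' x = 0" if "x > \<beta>" for x
    using that \<beta> by (simp add: W'_def W''_def power2_eq_square)
  have mono: "W 1 \<le> W x" if x: "0 \<le> x" "x \<le> 1" for x
  proof (rule DERIV_nonpos_imp_nonincreasing[OF x(2)])
    fix y assume y: "x \<le> y" "y \<le> 1"
    \<comment> \<open>The sign of the flux y * W' y settles every y > 0 but says nothing at y = 0;
      there the differential equation itself gives bes1 0 = - bes0 0.\<close>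
    have "W' y \<le> 0"
    proof (cases "y = 0")
      case True
      have "bes1 0 = - bes0 0" using bes_ode[of 0] by simp
      then show ?thesis using True \<beta> c bes0_bounds(1)[of 0] by (simp add: W'_def mult_nonneg_nonpos)
    next
      case False
      then have "y > 0" using x y by simp
      moreover have "y * W' y \<le> 0"
        using bes1_bounds(1)[of "c * y"] c01[of y] m \<open>y > 0\<close> y
        by (auto simp: W'_def mult_ac)
      ultimately show ?thesis by (simp add: mult_le_0_iff)
    qed
    then show "\<exists>d. (W has_real_derivative d) (at y) \<and> d \<le> 0" using W by blast
  qed
  \<comment> \<open>From - ln \<beta> \<le> 1/\<beta> - 1 and m \<ge> - (4/3) c \<beta> the
    logarithmic term at 1 is at least - (4/3) c (1 - \<beta>) \<ge> - 1/3, while the Bessel value at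
    the junction is at least 2/3.\<close>
  have pos: "W 1 > 0"
  proof -
    have l: "- ln \<beta> \<le> 1 / \<beta> - 1" "0 \<le> - ln \<beta>"
      using ln_le_minus_one[of "1 / \<beta>"] \<beta> by (auto simp: ln_div)
    have "- (1/3) \<le> - (4/3) * (c * (1 - \<beta>))"
      using mult_mono[of c "1/4" "1 - \<beta>" 1] c \<beta> by simp
    also have "\<dots> = - (4/3) * (c * \<beta>) * (1 / \<beta> - 1)" using \<beta> by (simp add: field_simps)
    also have "\<dots> \<le> - (4/3) * (c * \<beta>) * (- ln \<beta>)"
      using l c \<beta> by (intro mult_left_mono_neg) auto
    also have "\<dots> \<le> m * (- ln \<beta>)" using l m by (intro mult_right_mono) auto
    finally show ?thesis using \<beta> bes0_bounds(1)[of "c * \<beta>"] c01[of \<beta>] by (simp add: W_def)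
  qed
  show ?thesis
  proof (rule that[of "\<lambda>x. W x / W 1" "\<lambda>x. W' x / W 1" "\<lambda>x. W'' x / W 1" "max K0 (\<bar>m\<bar> / \<beta>\<^sup>2) / W 1"])
    show "((\<lambda>x. W x / W 1) has_real_derivative W' x / W 1) (at x)" for x
      by (rule DERIV_cdivide[OF W])
    show "continuous_on UNIV (\<lambda>x. W' x / W 1)" using pos by (intro continuous_intros W'c) auto
    show "((\<lambda>x. W' x / W 1) has_real_derivative W'' x / W 1) (at x)" if "x \<noteq> b\<^sup>2" for x
      using that by (intro DERIV_cdivide W'd) (simp add: \<beta>_def)
    show "(\<lambda>x. W'' x / W 1) \<in> borel_measurable borel" using W''m by measurable
    show "\<bar>W'' x / W 1\<bar> \<le> max K0 (\<bar>m\<bar> / \<beta>\<^sup>2) / W 1" if "0 \<le> x" "x \<le> 1" for x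
      using W''b[OF that] pos by (simp add: divide_right_mono)
    show "4 * (W' x / W 1 + x * (W'' x / W 1)) = - \<gamma> * (W x / W 1)" if "x < b\<^sup>2" for x
      using ode1[of x] that by (simp add: \<beta>_def flip: add_divide_distrib)
    show "W' x / W 1 + x * (W'' x / W 1) = 0" if "x > b\<^sup>2" for x
      using ode2[of x] that by (simp add: \<beta>_def flip: add_divide_distrib)
    show "1 \<le> W x / W 1" if "0 \<le> x" "x \<le> 1" for x using mono[OF that] pos by simp
  qed (use pos in auto)
qed


subsection \<open>Limits of products in square mean\<close>

lemma square_integrable_bounded:
  fixes f :: "'a \<Rightarrow> 'b::euclidean_space"
  assumes "finite_measure M" "f \<in> borel_measurable M" "\<And>x. x \<in> space M \<Longrightarrow> norm (f x) \<le> B"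
  shows "square_integrable M f"
  unfolding square_integrable_def
proof
  show "integrable M (\<lambda>x. (norm (f x))\<^sup>2)"
  proof (rule finite_measure.integrable_const_bound[OF assms(1), of _ "B\<^sup>2"])
    show "AE x in M. norm ((norm (f x))\<^sup>2) \<le> B\<^sup>2"
      using assms(3) by (intro AE_I2) (simp add: power_mono)
  qed (use assms(2) in measurable)
qed (fact assms(2))

lemma norm_diff_square_le: "(norm (a - b))\<^sup>2 \<le> 2 * (norm a)\<^sup>2 + 2 * (norm (b :: 'a::real_normed_vector))\<^sup>2"
proof -
  have "(norm (a - b))\<^sup>2 \<le> (norm a + norm b)\<^sup>2"
    by (intro power_mono norm_triangle_ineq4) auto
  also have "\<dots> \<le> 2 * (norm a)\<^sup>2 + 2 * (norm b)\<^sup>2"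
    using sum_squares_bound[of "norm a" "norm b"] by (simp add: power2_sum)
  finally show ?thesis .
qed

lemma square_integrable_diff:
  assumes "square_integrable M f" "square_integrable M g"
  shows "square_integrable M (\<lambda>x. f x - g x)"
  unfolding square_integrable_def
proof
  have [measurable]: "f \<in> borel_measurable M" "g \<in> borel_measurable M"
    using assms by (auto simp: square_integrable_def)
  show "(\<lambda>x. f x - g x) \<in> borel_measurable M" by measurable
  show "integrable M (\<lambda>x. (norm (f x - g x))\<^sup>2)"
  proof (rule Bochner_Integration.integrable_bound)
    show "integrable M (\<lambda>x. 2 * (norm (f x))\<^sup>2 + 2 * (norm (g x))\<^sup>2)"
      using assms by (auto simp: square_integrable_def)
    show "AE x in M. norm ((norm (f x - g x))\<^sup>2) \<le> norm (2 * (norm (f x))\<^sup>2 + 2 * (norm (g x))\<^sup>2)"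
      by (intro AE_I2) (use norm_diff_square_le in auto)
  qed measurable
qed

lemma square_integrable_dominated:
  assumes "square_integrable M f" "g \<in> borel_measurable M" "\<And>x. norm (g x) \<le> norm (f x)"
  shows "square_integrable M g"
  unfolding square_integrable_def
proof
  show "integrable M (\<lambda>x. (norm (g x))\<^sup>2)"
  proof (rule Bochner_Integration.integrable_bound)
    show "integrable M (\<lambda>x. (norm (f x))\<^sup>2)" using assms by (auto simp: square_integrable_def)
    show "AE x in M. norm ((norm (g x))\<^sup>2) \<le> norm ((norm (f x))\<^sup>2)"
      by (intro AE_I2) (simp add: power_mono assms(3))
  qed (use assms(2) in measurable)
qed (fact assms(2))

lemma square_integrable_integrable_mult:
  fixes f g m :: "'a \<Rightarrow> complex"
  assumes "square_integrable M f" "square_integrable M g"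
    and m: "m \<in> borel_measurable M" "AE x in M. norm (m x) \<le> B"
  shows "integrable M (\<lambda>x. m x * f x * g x)"
proof -
  have [measurable]: "f \<in> borel_measurable M" "g \<in> borel_measurable M" "m \<in> borel_measurable M"
    using assms by (auto simp: square_integrable_def)
  show ?thesis
  proof (rule Bochner_Integration.integrable_bound)
    show "integrable M (\<lambda>x. \<bar>B\<bar> * ((norm (f x))\<^sup>2 + (norm (g x))\<^sup>2))"
      using assms by (auto simp: square_integrable_def)
    show "AE x in M. norm (m x * f x * g x) \<le> norm (\<bar>B\<bar> * ((norm (f x))\<^sup>2 + (norm (g x))\<^sup>2))"
      using m(2)
    proof eventually_elim
      fix x assume x: "norm (m x) \<le> B"
      have "norm (f x) * norm (g x) \<le> (norm (f x))\<^sup>2 + (norm (g x))\<^sup>2"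
        using sum_squares_bound[of "norm (f x)" "norm (g x)"] mult_nonneg_nonneg[of "norm (f x)" "norm (g x)"]
        by (simp del: mult_nonneg_nonneg)
      then have "norm (m x) * (norm (f x) * norm (g x)) \<le> \<bar>B\<bar> * ((norm (f x))\<^sup>2 + (norm (g x))\<^sup>2)"
        using x by (intro mult_mono) auto
      then show "norm (m x * f x * g x) \<le> norm (\<bar>B\<bar> * ((norm (f x))\<^sup>2 + (norm (g x))\<^sup>2))"
        by (simp add: norm_mult mult.assoc)
    qed
  qed measurable
qed

text \<open>Young's inequality with a free weight d. Choosing d small but large compared with the
  error makes it do the work of the Cauchy-Schwarz inequality below.\<close>

lemma weighted_mult_le: "a * b \<le> d * a\<^sup>2 + b\<^sup>2 / d" if "0 < d" for a b d :: real
proof -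
  have "2 * (a * b) = 2 * (sqrt d * a) * (b / sqrt d)" using that by simp
  also have "\<dots> \<le> (sqrt d * a)\<^sup>2 + (b / sqrt d)\<^sup>2" by (rule sum_squares_bound)
  also have "\<dots> = d * a\<^sup>2 + b\<^sup>2 / d" using that by (simp add: power_mult_distrib power_divide)
  finally have "2 * (a * b) \<le> d * a\<^sup>2 + b\<^sup>2 / d" .
  moreover have "0 \<le> d * a\<^sup>2 + b\<^sup>2 / d" using that by simp
  ultimately show ?thesis by linarith
qed

text \<open>The error is split as F G - f g = (F - f)(G - g) + f (G - g) + g (F - f) and each
  product is bounded pointwise by the weighted inequality, with a weight d k that tends to 0 more
  slowly than the total square error s k. The bounded factor m carries the potential, coordinates or
  a fixed C1 function in the applications.\<close>

lemma L2_mult_tendsto: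
  fixes f g m :: "'a \<Rightarrow> complex" and F G :: "nat \<Rightarrow> 'a \<Rightarrow> complex"
  assumes f: "square_integrable M f" and g: "square_integrable M g"
    and F: "\<And>k. square_integrable M (F k)" and G: "\<And>k. square_integrable M (G k)"
    and m: "m \<in> borel_measurable M" "AE x in M. norm (m x) \<le> B"
    and Ff: "(\<lambda>k. LINT x|M. (norm (F k x - f x))\<^sup>2) \<longlonglongrightarrow> 0"
    and Gg: "(\<lambda>k. LINT x|M. (norm (G k x - g x))\<^sup>2) \<longlonglongrightarrow> 0"
  shows "(\<lambda>k. LINT x|M. m x * F k x * G k x) \<longlonglongrightarrow> (LINT x|M. m x * f x * g x)"
proof -
  define s where "s k = (LINT x|M. (norm (F k x - f x))\<^sup>2) + (LINT x|M. (norm (G k x - g x))\<^sup>2)" for k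
  define N where "N = (LINT x|M. (norm (f x))\<^sup>2) + (LINT x|M. (norm (g x))\<^sup>2)"
  \<comment> \<open>The summand 1/(k+1) keeps d k positive even when the error vanishes; the square
    root gives s k / d k \<le> d k, so both error contributions tend to 0.\<close>
  define d where "d k = sqrt (s k + 1 / real (Suc k))" for k
  have s0: "s k \<ge> 0" for k by (simp add: s_def)
  have d0: "d k > 0" for k unfolding d_def using s0[of k] by (simp add: add_nonneg_pos)
  have s: "s \<longlonglongrightarrow> 0" unfolding s_def using tendsto_add[OF Ff Gg] by simp
  have d: "d \<longlonglongrightarrow> 0"
    unfolding d_def using tendsto_real_sqrt[OF tendsto_add[OF s LIMSEQ_inverse_real_of_nat]]
    by (simp add: inverse_eq_divide)
  have sd: "s k / d k \<le> d k" for k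
  proof -
    have "s k \<le> d k * d k" using s0[of k] by (simp add: d_def)
    then show ?thesis using d0[of k] by (simp add: field_simps)
  qed
  have int: "integrable M (\<lambda>x. m x * p x * q x)" if "square_integrable M p" "square_integrable M q" for p q
    using square_integrable_integrable_mult[OF that m] .
  have dF: "square_integrable M (\<lambda>x. F k x - f x)" and dG: "square_integrable M (\<lambda>x. G k x - g x)" for k
    using square_integrable_diff f g F G by blast+
  have bound: "norm ((LINT x|M. m x * F k x * G k x) - (LINT x|M. m x * f x * g x))
      \<le> \<bar>B\<bar> * (s k + (d k * N + d k))" for k
  proof -
    have i: "integrable M (\<lambda>x. (norm (F k x - f x))\<^sup>2)" "integrable M (\<lambda>x. (norm (G k x - g x))\<^sup>2)"
       "integrable M (\<lambda>x. (norm (f x))\<^sup>2)" "integrable M (\<lambda>x. (norm (g x))\<^sup>2)"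
      using dF dG f g by (auto simp: square_integrable_def)
    let ?R = "\<lambda>x. \<bar>B\<bar> * (((norm (F k x - f x))\<^sup>2 + (norm (G k x - g x))\<^sup>2)
        + (d k * ((norm (f x))\<^sup>2 + (norm (g x))\<^sup>2) + ((norm (F k x - f x))\<^sup>2 + (norm (G k x - g x))\<^sup>2) / d k))"
    have "norm ((LINT x|M. m x * F k x * G k x) - (LINT x|M. m x * f x * g x))
        = norm (LINT x|M. m x * F k x * G k x - m x * f x * g x)"
      by (subst Bochner_Integration.integral_diff[OF int[OF F G] int[OF f g]]) simp
    also have "\<dots> \<le> (LINT x|M. ?R x)"
    proof (rule order_trans[OF integral_norm_bound integral_mono_AE])
      show "integrable M (\<lambda>x. norm (m x * F k x * G k x - m x * f x * g x))"
        using int[OF F G] int[OF f g] by simp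
      show "integrable M ?R" using i by simp
      show "AE x in M. norm (m x * F k x * G k x - m x * f x * g x) \<le> ?R x"
        using m(2)
      proof eventually_elim
        fix x assume x: "norm (m x) \<le> B"
        let ?a = "norm (F k x - f x)" and ?c = "norm (G k x - g x)"
        have e: "F k x * G k x - f x * g x = (F k x - f x) * (G k x - g x) + f x * (G k x - g x) + g x * (F k x - f x)"
          by (simp add: algebra_simps)
        have "norm (F k x * G k x - f x * g x) \<le> ?a * ?c + norm (f x) * ?c + norm (g x) * ?a"
          unfolding e by (intro norm_triangle_le add_mono) (auto simp: norm_mult)
        also have "?a * ?c \<le> ?a\<^sup>2 + ?c\<^sup>2" using weighted_mult_le[of 1 ?a ?c] by simp
        also have "norm (f x) * ?c \<le> d k * (norm (f x))\<^sup>2 + ?c\<^sup>2 / d k" by (rule weighted_mult_le[OF d0])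
        also have "norm (g x) * ?a \<le> d k * (norm (g x))\<^sup>2 + ?a\<^sup>2 / d k" by (rule weighted_mult_le[OF d0])
        finally have *: "norm (F k x * G k x - f x * g x) \<le> (?a\<^sup>2 + ?c\<^sup>2) + (d k * ((norm (f x))\<^sup>2 + (norm (g x))\<^sup>2) + (?a\<^sup>2 + ?c\<^sup>2) / d k)"
          by (simp add: algebra_simps add_divide_distrib)
        have "norm (m x * F k x * G k x - m x * f x * g x) = norm (m x) * norm (F k x * G k x - f x * g x)"
          by (simp add: algebra_simps flip: norm_mult)
        also have "\<dots> \<le> ?R x" using * x by (intro mult_mono) auto
        finally show "norm (m x * F k x * G k x - m x * f x * g x) \<le> ?R x" .
      qed
    qed
    also have "\<dots> = \<bar>B\<bar> * (s k + (d k * N + s k / d k))"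
      using i by (simp add: s_def N_def)
    also have "\<dots> \<le> \<bar>B\<bar> * (s k + (d k * N + d k))"
      using sd by (intro mult_left_mono) auto
    finally show ?thesis .
  qed
  have "(\<lambda>k. \<bar>B\<bar> * (s k + (d k * N + d k))) \<longlonglongrightarrow> \<bar>B\<bar> * (0 + (0 * N + 0))"
    by (intro tendsto_intros s d)
  then have "(\<lambda>k. (LINT x|M. m x * F k x * G k x) - (LINT x|M. m x * f x * g x)) \<longlonglongrightarrow> 0"
    by (intro Lim_null_comparison[OF always_eventually[OF allI[OF bound]]]) simp
  then show ?thesis by (rule LIM_zero_cancel)
qed


subsection \<open>Green formulas on the disk\<close>

lemma mem_unit_disk: "(x, y) \<in> unit_disk \<longleftrightarrow> x\<^sup>2 + y\<^sup>2 < 1"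
  by (simp add: unit_disk_def dist_norm norm_Pair real_sqrt_lt_1_iff)

lemma sets_unit_disk [measurable]: "unit_disk \<in> sets borel"
  by (simp add: unit_disk_def)

lemma unit_disk_lmeasurable: "unit_disk \<in> lmeasurable"
  by (simp add: unit_disk_def)

lemma finite_measure_disk: "finite_measure disk_measure"
  by (intro finite_measure_lebesgue_on unit_disk_lmeasurable)

lemma finite_measure_angle: "finite_measure angle_measure"
  by (intro finite_measure_lebesgue_on) auto

lemma integrable_disk_bounded:
  fixes f :: "plane \<Rightarrow> 'b::euclidean_space"
  assumes "f \<in> borel_measurable borel" "\<And>p. p \<in> unit_disk \<Longrightarrow> norm (f p) \<le> B"
  shows "integrable disk_measure f"
  by (rule finite_measure.integrable_const_bound[OF finite_measure_disk, of _ B])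
     (use assms in \<open>auto intro!: AE_I2 measurable_restrict_space1 measurable_completion\<close>)

text \<open>\<open>disk_measure\<close> restricts the completed Lebesgue measure, while slicing by
  Fubini takes place on the product of two copies of \<open>lborel\<close>. For Borel functions the
  integrals agree.\<close>

lemma integrable_lborel_disk:
  fixes f :: "plane \<Rightarrow> complex"
  assumes "f \<in> borel_measurable borel" "\<And>p. p \<in> unit_disk \<Longrightarrow> norm (f p) \<le> B"
  shows "integrable lborel (\<lambda>p. indicator unit_disk p *\<^sub>R f p)"
    and "(LINT p|disk_measure. f p) = (LINT p|lborel. indicator unit_disk p *\<^sub>R f p)"
proof -
  show "integrable lborel (\<lambda>p. indicator unit_disk p *\<^sub>R f p)"
    by (rule integrableI_bounded_set_indicator[where B = B])
       (use assms emeasure_bounded_finite[of unit_disk] in \<open>auto simp: unit_disk_def bounded_ball\<close>)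
  have "(LINT p|disk_measure. f p) = (LINT p|lebesgue. indicator unit_disk p *\<^sub>R f p)"
    by (rule integral_restrict_space) (auto simp: unit_disk_lmeasurable fmeasurableD)
  also have "\<dots> = (LINT p|lborel. indicator unit_disk p *\<^sub>R f p)"
    by (rule integral_completion) (use assms(1) in measurable)
  finally show "(LINT p|disk_measure. f p) = (LINT p|lborel. indicator unit_disk p *\<^sub>R f p)" .
qed

lemma sqrt_bound_iff: "x\<^sup>2 + y\<^sup>2 < 1 \<longleftrightarrow> x \<in> {-sqrt (1 - y\<^sup>2)<..<sqrt (1 - y\<^sup>2)}" for x y :: real
  using real_less_lsqrt[of "\<bar>x\<bar>" "1 - y\<^sup>2"] real_le_lsqrt real_sqrt_less_iff[of "x\<^sup>2" "1 - y\<^sup>2"]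
  by auto

text \<open>Both Green formulas on the disk reduce to the fundamental theorem of calculus on the chords
  \<open>{-sqrt (1 - y\<^sup>2)<..<sqrt (1 - y\<^sup>2)}\<close>; a finite exceptional set on each chord lets
  the radial solution be only piecewise twice differentiable.\<close>

lemma chord_integral:
  fixes F D :: "real \<Rightarrow> complex"
  assumes S: "finite S" and F: "continuous_on UNIV F"
    and D: "\<And>x. x \<notin> S \<Longrightarrow> (F has_vector_derivative D x) (at x)"
    and int: "integrable lborel (\<lambda>x. indicator {x. x\<^sup>2 + y\<^sup>2 < 1} x *\<^sub>R D x)"
  shows "(LINT x|lborel. indicator {x. x\<^sup>2 + y\<^sup>2 < 1} x *\<^sub>R D x)
     = (if y \<in> {-1<..<1} then F (sqrt (1 - y\<^sup>2)) - F (- sqrt (1 - y\<^sup>2)) else 0)"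
proof (cases "y \<in> {-1<..<1}")
  case True
  then have y: "y\<^sup>2 < 1" by (simp add: abs_square_less_1 abs_less_iff)
  define s where "s = sqrt (1 - y\<^sup>2)"
  have s: "0 < s" using y by (simp add: s_def)
  have "(D has_integral F s - F (- s)) {- s..s}"
    by (rule fundamental_theorem_of_calculus_interior_strong[OF S])
       (use s D F in \<open>auto intro: continuous_on_subset\<close>)
  then have "(D has_integral F s - F (- s)) {- s<..<s}" by (simp add: has_integral_Icc_iff_Ioo)
  then have "((\<lambda>x. if x \<in> {- s<..<s} then D x else 0) has_integral F s - F (- s)) UNIV"
    by (simp only: has_integral_restrict_UNIV)
  moreover have "(\<lambda>x. if x \<in> {- s<..<s} then D x else 0) = (\<lambda>x. indicator {x. x\<^sup>2 + y\<^sup>2 < 1} x *\<^sub>R D x)"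
    unfolding s_def by (auto simp: sqrt_bound_iff indicator_def fun_eq_iff)
  ultimately show ?thesis
    using has_integral_integral_lborel[OF int] True by (auto simp: s_def dest: has_integral_unique)
next
  case False
  then have "\<not> y\<^sup>2 < 1" by (auto simp: abs_square_less_1 abs_less_iff)
  then have "\<not> x\<^sup>2 + y\<^sup>2 < 1" for x using zero_le_power2[of x] by linarith
  then show ?thesis using False by auto
qed

lemma chord_difference_integral:
  fixes K :: "real \<Rightarrow> complex"
  assumes "integrable lborel (\<lambda>y. if y \<in> {-1<..<1} then K y else 0)"
  shows "(LINT y|lborel. (if y \<in> {-1<..<1} then K y else 0)) = integral {-1..1} K"
proof -
  have "(K has_integral (LINT y|lborel. (if y \<in> {-1<..<1} then K y else 0))) {-1<..<1}"
    using has_integral_integral_lborel[OF assms] by (simp only: has_integral_restrict_UNIV)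
  then show ?thesis
    by (intro integral_unique[symmetric]) (simp only: has_integral_Icc_iff_Ioo)
qed

section \<open>Boundary integrals rewritten as integrals over chord ends\<close>

lemma LINT_angle_eq_integral:
  fixes f :: "real \<Rightarrow> complex"
  assumes "continuous_on {0..2 * pi} f"
  shows "(LINT t|angle_measure. f t) = integral {0..2 * pi} f"
  by (intro lebesgue_integral_eq_integral continuous_imp_integrable_real assms) auto

text \<open>Substitution y = sin t. The cosine changes sign at pi/2 and 3 pi/2; the right half of
  the circle is seen in two arcs, the first and the last, because the parameter runs over [0, 2 pi],
  and the left half contributes with reversed orientation.\<close>

lemma cos_integral_eq_chord:
  fixes F :: "real \<times> real \<Rightarrow> complex"
  assumes F: "continuous_on UNIV F"
  shows "(LINT t|angle_measure. of_real (cos t) * F (cos t, sin t))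
    = integral {-1..1} (\<lambda>y. F (sqrt (1 - y\<^sup>2), y) - F (- sqrt (1 - y\<^sup>2), y))"
proof -
  define f1 where "f1 y = F (sqrt (1 - y\<^sup>2), y)" for y
  define f2 where "f2 y = F (- sqrt (1 - y\<^sup>2), y)" for y
  define h where "h t = of_real (cos t) * F (cos t, sin t)" for t
  have c1: "continuous_on {-1..1} f1" unfolding f1_def
    by (rule continuous_on_compose2[OF F]) (auto intro!: continuous_intros)
  have c2: "continuous_on {-1..1} f2" unfolding f2_def
    by (rule continuous_on_compose2[OF F]) (auto intro!: continuous_intros)
  have ch: "continuous_on A h" for A unfolding h_def
    by (intro continuous_intros continuous_on_compose2[OF F]) auto
  have i: "h integrable_on {a..b}" for a b by (rule integrable_continuous_real[OF ch])
  have c: "sqrt (1 - (sin t)\<^sup>2) = \<bar>cos t\<bar>" for t by (simp flip: cos_squared_eq)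
  \<comment> \<open>Of the two intervals in the difference at least one is empty or a point, so a
    single formula covers arcs on which the sine increases and arcs on which it decreases
    overall.\<close>
  have sub: "((\<lambda>t. cos t *\<^sub>R g (sin t)) has_integral (integral {sin a..sin b} g - integral {sin b..sin a} g)) {a..b}"
    if "a \<le> b" "continuous_on {-1..1} g" for a b and g :: "real \<Rightarrow> complex"
    by (rule has_integral_substitution_general[of "{}" a b sin "-1" 1])
       (use that in \<open>auto intro!: continuous_intros derivative_eq_intros\<close>)
  have h1: "integral {0..pi/2} h = integral {0..1} f1"
  proof (rule integral_unique)
    have "((\<lambda>t. cos t *\<^sub>R f1 (sin t)) has_integral integral {0..1} f1) {0..pi/2}"
      using sub[of 0 "pi/2" f1] c1 by simp
    then show "(h has_integral integral {0..1} f1) {0..pi/2}"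
    proof (rule has_integral_eq[rotated])
      fix t assume "t \<in> {0..pi/2}"
      then have "0 \<le> cos t" by (intro cos_ge_zero) auto
      then show "cos t *\<^sub>R f1 (sin t) = h t" by (simp add: f1_def h_def c scaleR_conv_of_real)
    qed
  qed
  have h2: "integral {pi/2..3*pi/2} h = - integral {-1..1} f2"
  proof (rule integral_unique)
    have "sin (3*pi/2) = -1" using sin_3over2_pi by (simp add: mult.commute)
    then have "((\<lambda>t. cos t *\<^sub>R f2 (sin t)) has_integral - integral {-1..1} f2) {pi/2..3*pi/2}"
      using sub[of "pi/2" "3*pi/2" f2] c2 by simp
    then show "(h has_integral - integral {-1..1} f2) {pi/2..3*pi/2}"
    proof (rule has_integral_eq[rotated])
      fix t assume t: "t \<in> {pi/2..3*pi/2}"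
      have "0 \<le> cos (t - pi)" using t by (intro cos_ge_zero) auto
      then have "cos t \<le> 0" by simp
      then show "cos t *\<^sub>R f2 (sin t) = h t" by (simp add: f2_def h_def c scaleR_conv_of_real)
    qed
  qed
  have h3: "integral {3*pi/2..2*pi} h = integral {-1..0} f1"
  proof (rule integral_unique)
    have "sin (3*pi/2) = -1" using sin_3over2_pi by (simp add: mult.commute)
    then have "((\<lambda>t. cos t *\<^sub>R f1 (sin t)) has_integral integral {-1..0} f1) {3*pi/2..2*pi}"
      using sub[of "3*pi/2" "2*pi" f1] c1 by simp
    then show "(h has_integral integral {-1..0} f1) {3*pi/2..2*pi}"
    proof (rule has_integral_eq[rotated])
      fix t assume t: "t \<in> {3*pi/2..2*pi}"
      have "0 \<le> cos (t - 2*pi)" using t by (intro cos_ge_zero) auto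
      then have "cos t \<ge> 0" by (simp add: cos_diff)
      then show "cos t *\<^sub>R f1 (sin t) = h t" by (simp add: f1_def h_def c scaleR_conv_of_real)
    qed
  qed
  have "(LINT t|angle_measure. h t) = integral {0..2*pi} h" by (rule LINT_angle_eq_integral[OF ch])
  also have "\<dots> = integral {0..pi/2} h + integral {pi/2..3*pi/2} h + integral {3*pi/2..2*pi} h"
    by (simp add: Henstock_Kurzweil_Integration.integral_combine[OF _ _ i])
  also have "\<dots> = (integral {-1..0} f1 + integral {0..1} f1) - integral {-1..1} f2"
    by (simp add: h1 h2 h3)
  also have "integral {-1..0} f1 + integral {0..1} f1 = integral {-1..1} f1"
    by (rule Henstock_Kurzweil_Integration.integral_combine) (auto intro: integrable_continuous_real c1)
  also have "integral {-1..1} f1 - integral {-1..1} f2 = integral {-1..1} (\<lambda>y. f1 y - f2 y)"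
    by (rule Henstock_Kurzweil_Integration.integral_diff[symmetric]) (auto intro: integrable_continuous_real c1 c2)
  finally show ?thesis by (simp add: h_def f1_def f2_def)
qed

text \<open>Substitution x = cos t; here the only interior sign change of the sine is at pi, so two
  arcs are enough.\<close>

lemma sin_integral_eq_chord:
  fixes F :: "real \<times> real \<Rightarrow> complex"
  assumes F: "continuous_on UNIV F"
  shows "(LINT t|angle_measure. of_real (sin t) * F (cos t, sin t))
    = integral {-1..1} (\<lambda>x. F (x, sqrt (1 - x\<^sup>2)) - F (x, - sqrt (1 - x\<^sup>2)))"
proof -
  define f1 where "f1 x = F (x, sqrt (1 - x\<^sup>2))" for x
  define f2 where "f2 x = F (x, - sqrt (1 - x\<^sup>2))" for x
  define h where "h t = of_real (sin t) * F (cos t, sin t)" for t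
  have c1: "continuous_on {-1..1} f1" unfolding f1_def
    by (rule continuous_on_compose2[OF F]) (auto intro!: continuous_intros)
  have c2: "continuous_on {-1..1} f2" unfolding f2_def
    by (rule continuous_on_compose2[OF F]) (auto intro!: continuous_intros)
  have ch: "continuous_on A h" for A unfolding h_def
    by (intro continuous_intros continuous_on_compose2[OF F]) auto
  have i: "h integrable_on {a..b}" for a b by (rule integrable_continuous_real[OF ch])
  have c: "sqrt (1 - (cos t)\<^sup>2) = \<bar>sin t\<bar>" for t by (simp flip: sin_squared_eq)
  have sub: "((\<lambda>t. (- sin t) *\<^sub>R g (cos t)) has_integral (integral {cos a..cos b} g - integral {cos b..cos a} g)) {a..b}"
    if "a \<le> b" "continuous_on {-1..1} g" for a b and g :: "real \<Rightarrow> complex"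
    by (rule has_integral_substitution_general[of "{}" a b cos "-1" 1])
       (use that in \<open>auto intro!: continuous_intros derivative_eq_intros\<close>)
  have h1: "integral {0..pi} h = integral {-1..1} f1"
  proof (rule integral_unique)
    have "((\<lambda>t. - ((- sin t) *\<^sub>R f1 (cos t))) has_integral integral {-1..1} f1) {0..pi}"
      using has_integral_neg[OF sub[of 0 "pi" f1]] c1 by simp
    then show "(h has_integral integral {-1..1} f1) {0..pi}"
    proof (rule has_integral_eq[rotated])
      fix t assume "t \<in> {0..pi}"
      then have "0 \<le> sin t" by (intro sin_ge_zero) auto
      then show "- ((- sin t) *\<^sub>R f1 (cos t)) = h t" by (simp add: f1_def h_def c scaleR_conv_of_real)
    qed
  qed
  have h2: "integral {pi..2*pi} h = - integral {-1..1} f2"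
  proof (rule integral_unique)
    have "((\<lambda>t. - ((- sin t) *\<^sub>R f2 (cos t))) has_integral - integral {-1..1} f2) {pi..2*pi}"
      using has_integral_neg[OF sub[of pi "2*pi" f2]] c2 by simp
    then show "(h has_integral - integral {-1..1} f2) {pi..2*pi}"
    proof (rule has_integral_eq[rotated])
      fix t assume t: "t \<in> {pi..2*pi}"
      have "0 \<le> sin (t - pi)" using t by (intro sin_ge_zero) auto
      then have "sin t \<le> 0" by simp
      then show "- ((- sin t) *\<^sub>R f2 (cos t)) = h t" by (simp add: f2_def h_def c scaleR_conv_of_real)
    qed
  qed
  have "(LINT t|angle_measure. h t) = integral {0..2*pi} h" by (rule LINT_angle_eq_integral[OF ch])
  also have "\<dots> = integral {0..pi} h + integral {pi..2*pi} h"
    by (simp add: Henstock_Kurzweil_Integration.integral_combine[OF _ _ i])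
  also have "\<dots> = integral {-1..1} f1 - integral {-1..1} f2"
    by (simp add: h1 h2)
  also have "integral {-1..1} f1 - integral {-1..1} f2 = integral {-1..1} (\<lambda>y. f1 y - f2 y)"
    by (rule Henstock_Kurzweil_Integration.integral_diff[symmetric]) (auto intro: integrable_continuous_real c1 c2)
  finally show ?thesis by (simp add: h_def f1_def f2_def)
qed

text \<open>The divergence theorem for the field (F, 0): its outward flux density on the circle is
  cos t * F. The disk is sliced into horizontal chords, and the finite exceptional set may vary with
  the height y.\<close>

lemma green_disk_x:
  fixes F D :: "plane \<Rightarrow> complex"
  assumes F: "continuous_on UNIV F"
    and D: "D \<in> borel_measurable borel" "\<And>p. p \<in> unit_disk \<Longrightarrow> norm (D p) \<le> B"
    and S: "\<And>y. finite (S y)"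
    and d: "\<And>x y. x \<notin> S y \<Longrightarrow> ((\<lambda>x. F (x, y)) has_vector_derivative D (x, y)) (at x)"
  shows "(LINT p|disk_measure. D p) = (LINT t|angle_measure. of_real (cos t) * F (cos t, sin t))"
proof -
  let ?g = "\<lambda>x y. indicator unit_disk (x, y) *\<^sub>R D (x, y)"
  have ig: "integrable (lborel \<Otimes>\<^sub>M lborel) (case_prod ?g)"
    using integrable_lborel_disk(1)[OF D] by (simp add: lborel_prod case_prod_unfold)
  have inner: "(LINT x|lborel. ?g x y) =
      (if y \<in> {-1<..<1} then F (sqrt (1 - y\<^sup>2), y) - F (- sqrt (1 - y\<^sup>2), y) else 0)" for y
  proof -
    have e: "?g x y = indicator {x. x\<^sup>2 + y\<^sup>2 < 1} x *\<^sub>R D (x, y)" for x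
      by (simp add: mem_unit_disk indicator_def)
    have m: "(\<lambda>x. D (x, y)) \<in> borel_measurable borel"
      by (rule measurable_compose[OF borel_measurable_continuous_onI D(1)]) (intro continuous_intros)
    have "integrable lborel (\<lambda>x. indicator {x. x\<^sup>2 + y\<^sup>2 < 1} x *\<^sub>R D (x, y))"
    proof (rule integrableI_bounded_set[where A = "{-1..1}" and B = "max B 0"])
      show "(\<lambda>x. indicator {x. x\<^sup>2 + y\<^sup>2 < 1} x *\<^sub>R D (x, y)) \<in> borel_measurable lborel"
        using m by measurable
      show "AE x in lborel. x \<in> {-1..1} \<longrightarrow> norm (indicator {x. x\<^sup>2 + y\<^sup>2 < 1} x *\<^sub>R D (x, y)) \<le> max B 0"
        using D(2) by (intro AE_I2) (auto simp: indicator_def mem_unit_disk le_max_iff_disj)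
      show "AE x in lborel. x \<notin> {-1..1} \<longrightarrow> indicator {x. x\<^sup>2 + y\<^sup>2 < 1} x *\<^sub>R D (x, y) = 0"
      proof (intro AE_I2 impI)
        fix x :: real assume "x \<notin> {-1..1}"
        then have "\<not> x\<^sup>2 < 1" by (auto simp: abs_square_less_1 abs_less_iff)
        then have "\<not> x\<^sup>2 + y\<^sup>2 < 1" using zero_le_power2[of y] by linarith
        then show "indicator {x. x\<^sup>2 + y\<^sup>2 < 1} x *\<^sub>R D (x, y) = 0" by simp
      qed
    qed auto
    moreover have "continuous_on UNIV (\<lambda>x. F (x, y))"
      by (rule continuous_on_compose2[OF F]) (auto intro!: continuous_intros)
    ultimately show ?thesis
      unfolding e using d by (intro chord_integral[OF S]) auto
  qed
  have "(LINT p|disk_measure. D p) = (LINT p|(lborel \<Otimes>\<^sub>M lborel). case_prod ?g p)"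
    using integrable_lborel_disk(2)[OF D] by (simp add: lborel_prod case_prod_unfold)
  also have "\<dots> = (LINT y|lborel. LINT x|lborel. ?g x y)"
    by (rule lborel_pair.integral_snd[OF ig, symmetric])
  also have "\<dots> = integral {-1..1} (\<lambda>y. F (sqrt (1 - y\<^sup>2), y) - F (- sqrt (1 - y\<^sup>2), y))"
    using lborel_pair.integrable_snd[OF ig] unfolding inner by (rule chord_difference_integral)
  also have "\<dots> = (LINT t|angle_measure. of_real (cos t) * F (cos t, sin t))"
    by (rule cos_integral_eq_chord[OF F, symmetric])
  finally show ?thesis .
qed

text \<open>The divergence theorem for the field (0, F), with vertical chords and flux density sin t
  * F.\<close>

lemma green_disk_y:
  fixes F D :: "plane \<Rightarrow> complex"
  assumes F: "continuous_on UNIV F"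
    and D: "D \<in> borel_measurable borel" "\<And>p. p \<in> unit_disk \<Longrightarrow> norm (D p) \<le> B"
    and S: "\<And>x. finite (S x)"
    and d: "\<And>x y. y \<notin> S x \<Longrightarrow> ((\<lambda>y. F (x, y)) has_vector_derivative D (x, y)) (at y)"
  shows "(LINT p|disk_measure. D p) = (LINT t|angle_measure. of_real (sin t) * F (cos t, sin t))"
proof -
  let ?g = "\<lambda>x y. indicator unit_disk (x, y) *\<^sub>R D (x, y)"
  have ig: "integrable (lborel \<Otimes>\<^sub>M lborel) (\<lambda>(x, y). ?g x y)"
    using integrable_lborel_disk(1)[OF D] by (simp add: lborel_prod case_prod_unfold)
  have inner: "(LINT y|lborel. ?g x y) =
      (if x \<in> {-1<..<1} then F (x, sqrt (1 - x\<^sup>2)) - F (x, - sqrt (1 - x\<^sup>2)) else 0)" for x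
  proof -
    have e: "?g x y = indicator {y. y\<^sup>2 + x\<^sup>2 < 1} y *\<^sub>R D (x, y)" for y
      by (simp add: mem_unit_disk indicator_def add.commute)
    have m: "(\<lambda>y. D (x, y)) \<in> borel_measurable borel"
      by (rule measurable_compose[OF borel_measurable_continuous_onI D(1)]) (intro continuous_intros)
    have "integrable lborel (\<lambda>y. indicator {y. y\<^sup>2 + x\<^sup>2 < 1} y *\<^sub>R D (x, y))"
    proof (rule integrableI_bounded_set[where A = "{-1..1}" and B = "max B 0"])
      show "(\<lambda>y. indicator {y. y\<^sup>2 + x\<^sup>2 < 1} y *\<^sub>R D (x, y)) \<in> borel_measurable lborel"
        using m by measurable
      show "AE y in lborel. y \<in> {-1..1} \<longrightarrow> norm (indicator {y. y\<^sup>2 + x\<^sup>2 < 1} y *\<^sub>R D (x, y)) \<le> max B 0"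
        using D(2) by (intro AE_I2) (auto simp: indicator_def mem_unit_disk le_max_iff_disj add.commute)
      show "AE y in lborel. y \<notin> {-1..1} \<longrightarrow> indicator {y. y\<^sup>2 + x\<^sup>2 < 1} y *\<^sub>R D (x, y) = 0"
      proof (intro AE_I2 impI)
        fix y :: real assume "y \<notin> {-1..1}"
        then have "\<not> y\<^sup>2 < 1" by (auto simp: abs_square_less_1 abs_less_iff)
        then have "\<not> y\<^sup>2 + x\<^sup>2 < 1" using zero_le_power2[of x] by linarith
        then show "indicator {y. y\<^sup>2 + x\<^sup>2 < 1} y *\<^sub>R D (x, y) = 0" by simp
      qed
    qed auto
    moreover have "continuous_on UNIV (\<lambda>y. F (x, y))"
      by (rule continuous_on_compose2[OF F]) (auto intro!: continuous_intros)
    ultimately show ?thesis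
      unfolding e using d by (intro chord_integral[OF S]) auto
  qed
  have "(LINT p|disk_measure. D p) = (LINT p|(lborel \<Otimes>\<^sub>M lborel). case_prod ?g p)"
    using integrable_lborel_disk(2)[OF D] by (simp add: lborel_prod case_prod_unfold)
  also have "\<dots> = (LINT x|lborel. LINT y|lborel. ?g x y)"
    using lborel_pair.integral_fst'[OF ig] by (simp add: case_prod_unfold)
  also have "\<dots> = integral {-1..1} (\<lambda>x. F (x, sqrt (1 - x\<^sup>2)) - F (x, - sqrt (1 - x\<^sup>2)))"
    using lborel_pair.integrable_fst'[OF ig] unfolding case_prod_conv inner by (rule chord_difference_integral)
  also have "\<dots> = (LINT t|angle_measure. of_real (sin t) * F (cos t, sin t))"
    by (rule sin_integral_eq_chord[OF F, symmetric])
  finally show ?thesis .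
qed


subsection \<open>Continuously differentiable functions and traces\<close>

definition C1 :: "(plane \<Rightarrow> complex) \<Rightarrow> bool" where
  "C1 = Ck 1"

lemma C1_iff: "C1 \<phi> \<longleftrightarrow> (\<forall>x. \<phi> differentiable (at x)) \<and>
    continuous_on UNIV (\<lambda>p. fst (grad \<phi> p)) \<and> continuous_on UNIV (\<lambda>p. snd (grad \<phi> p))"
  by (simp only: C1_def One_nat_def Ck.simps)

lemma C1D:
  assumes "C1 \<phi>"
  shows "continuous_on UNIV \<phi>"
    and "continuous_on UNIV (\<lambda>p. fst (grad \<phi> p))" "continuous_on UNIV (\<lambda>p. snd (grad \<phi> p))"
    and "((\<lambda>x. \<phi> (x, y)) has_vector_derivative fst (grad \<phi> (x, y))) (at x)"
    and "((\<lambda>y. \<phi> (x, y)) has_vector_derivative snd (grad \<phi> (x, y))) (at y)"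
proof -
  have d: "\<phi> differentiable at p" for p using assms by (simp only: C1_iff)
  then show "continuous_on UNIV \<phi>"
    by (intro continuous_at_imp_continuous_on) (auto intro: differentiable_imp_continuous_within)
  show "continuous_on UNIV (\<lambda>p. fst (grad \<phi> p))" "continuous_on UNIV (\<lambda>p. snd (grad \<phi> p))"
    using assms by (simp_all only: C1_iff)
  have f: "(\<phi> has_derivative frechet_derivative \<phi> (at p)) (at p)" for p
    using d frechet_derivative_works by blast
  have lin: "linear (frechet_derivative \<phi> (at p))" for p
    using f has_derivative_linear by blast
  have "((\<lambda>x. \<phi> (x, y)) has_derivative (\<lambda>h. frechet_derivative \<phi> (at (x, y)) (h, 0))) (at x)"
    by (rule has_derivative_compose[where f = "\<lambda>x. (x, y)" and g = \<phi> and x = x, OF _ f]) (auto intro!: derivative_eq_intros)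
  moreover have "frechet_derivative \<phi> (at (x, y)) (h, 0) = h *\<^sub>R fst (grad \<phi> (x, y))" for h
    using linear_scale[OF lin[of "(x, y)"], of h "(1, 0)"] by (simp add: grad_def)
  ultimately show "((\<lambda>x. \<phi> (x, y)) has_vector_derivative fst (grad \<phi> (x, y))) (at x)"
    by (simp add: has_vector_derivative_def)
  have "((\<lambda>y. \<phi> (x, y)) has_derivative (\<lambda>h. frechet_derivative \<phi> (at (x, y)) (0, h))) (at y)"
    by (rule has_derivative_compose[where f = "\<lambda>y. (x, y)" and g = \<phi> and x = y, OF _ f]) (auto intro!: derivative_eq_intros)
  moreover have "frechet_derivative \<phi> (at (x, y)) (0, h) = h *\<^sub>R snd (grad \<phi> (x, y))" for h
    using linear_scale[OF lin[of "(x, y)"], of h "(0, 1)"] by (simp add: grad_def)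
  ultimately show "((\<lambda>y. \<phi> (x, y)) has_vector_derivative snd (grad \<phi> (x, y))) (at y)"
    by (simp add: has_vector_derivative_def)
qed

lemma grad_continuous:
  assumes "C1 \<phi>"
  shows "continuous_on UNIV (grad \<phi>)"
  using continuous_on_Pair[OF C1D(2,3)[OF assms]] by simp

text \<open>Uniqueness of the Frechet derivative identifies \<open>grad\<close>, so exhibiting
  continuous partial derivatives yields both the regularity and the gradient as an equation of
  functions.\<close>

lemma C1I:
  assumes d: "\<And>p. (\<phi> has_derivative (\<lambda>h. fst h *\<^sub>R a p + snd h *\<^sub>R c p)) (at p)"
    and "continuous_on UNIV a" "continuous_on UNIV c"
  shows "C1 \<phi>" "grad \<phi> = (\<lambda>p. (a p, c p))"
proof -
  show g: "grad \<phi> = (\<lambda>p. (a p, c p))"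
    by (rule ext) (simp add: grad_def frechet_derivative_at[OF d, symmetric])
  show "C1 \<phi>" unfolding C1_iff g using assms by (auto simp: differentiable_def)
qed

lemma borel_measurable_disk:
  "f \<in> borel_measurable borel \<Longrightarrow> f \<in> borel_measurable disk_measure"
  by (intro measurable_restrict_space1 measurable_completion) simp

lemma borel_measurable_angle:
  "f \<in> borel_measurable borel \<Longrightarrow> f \<in> borel_measurable angle_measure"
  by (intro measurable_restrict_space1 measurable_completion) simp

lemma continuous_bounded_disk:
  fixes f :: "plane \<Rightarrow> 'b::euclidean_space"
  assumes "continuous_on UNIV f"
  shows "\<exists>B. (\<forall>p\<in>unit_disk. norm (f p) \<le> B) \<and> (\<forall>t. norm (f (cos t, sin t)) \<le> B)"
proof -
  have "bounded (f ` cball 0 1)"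
    using assms by (intro compact_imp_bounded compact_continuous_image continuous_on_subset[OF assms]) auto
  then obtain B where B: "\<And>p. p \<in> cball 0 1 \<Longrightarrow> norm (f p) \<le> B"
    unfolding bounded_iff by (metis imageI)
  show ?thesis
    by (intro exI[of _ B] conjI ballI allI B) (auto simp: unit_disk_def norm_Pair)
qed

lemma continuous_square_integrable_disk:
  fixes f :: "plane \<Rightarrow> 'b::euclidean_space"
  assumes "continuous_on UNIV f"
  shows "square_integrable disk_measure f"
proof -
  obtain B where "\<And>p. p \<in> unit_disk \<Longrightarrow> norm (f p) \<le> B"
    using continuous_bounded_disk[OF assms] by blast
  then show ?thesis
    by (intro square_integrable_bounded[OF finite_measure_disk, of _ B] borel_measurable_disk
        borel_measurable_continuous_onI assms) auto
qed

lemma continuous_square_integrable_angle: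
  fixes f :: "plane \<Rightarrow> 'b::euclidean_space"
  assumes "continuous_on UNIV f"
  shows "square_integrable angle_measure (\<lambda>t. f (cos t, sin t))"
proof -
  obtain B where "\<And>t. norm (f (cos t, sin t)) \<le> B"
    using continuous_bounded_disk[OF assms] by blast
  moreover have "continuous_on UNIV (\<lambda>t. f (cos t, sin t))"
    by (rule continuous_on_compose2[OF assms]) (auto intro!: continuous_intros)
  ultimately show ?thesis
    by (intro square_integrable_bounded[OF finite_measure_angle, of _ B] borel_measurable_angle
        borel_measurable_continuous_onI) auto
qed

section \<open>Square-mean convergence under contractions and differences\<close>

lemma LINT_norm_square_contraction:
  fixes f g :: "'a \<Rightarrow> 'b::euclidean_space" and L :: "'b \<Rightarrow> 'c::euclidean_space"
  assumes f: "square_integrable M f" and L: "L \<in> borel_measurable borel" "\<And>a. norm (L a) \<le> norm a"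
  shows "(LINT x|M. (norm (L (f x)))\<^sup>2) \<le> (LINT x|M. (norm (f x))\<^sup>2)"
proof -
  have "square_integrable M (\<lambda>x. L (f x))"
    using f L by (intro square_integrable_dominated[OF f]) (auto simp: square_integrable_def)
  then show ?thesis
    using f L by (intro integral_mono power_mono) (auto simp: square_integrable_def)
qed

text \<open>Applied with L a coordinate projection of the gradient or complex conjugation; linearity
  turns the difference of images into the image of the difference.\<close>

lemma L2_tendsto_dominated:
  fixes F :: "nat \<Rightarrow> 'a \<Rightarrow> 'b::euclidean_space" and L :: "'b \<Rightarrow> 'c::euclidean_space"
  assumes "square_integrable M f" "\<And>k. square_integrable M (F k)"
    and L: "bounded_linear L" "\<And>a. norm (L a) \<le> norm a"
    and lim: "(\<lambda>k. LINT x|M. (norm (F k x - f x))\<^sup>2) \<longlonglongrightarrow> 0"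
  shows "(\<lambda>k. LINT x|M. (norm (L (F k x) - L (f x)))\<^sup>2) \<longlonglongrightarrow> 0"
proof (rule tendsto_sandwich[OF _ _ tendsto_const lim])
  have "L \<in> borel_measurable borel"
    by (intro borel_measurable_continuous_onI linear_continuous_on L)
  then show "\<forall>\<^sub>F k in sequentially. (LINT x|M. (norm (L (F k x) - L (f x)))\<^sup>2) \<le> (LINT x|M. (norm (F k x - f x))\<^sup>2)"
    using LINT_norm_square_contraction[OF square_integrable_diff[OF assms(2,1)] _ L(2)]
    by (intro always_eventually allI) (simp add: linear_diff[OF bounded_linear.linear[OF L(1)]])
qed simp

lemma L2_tendsto_diff:
  fixes F G :: "nat \<Rightarrow> 'a \<Rightarrow> 'b::euclidean_space"
  assumes f: "square_integrable M f" "\<And>k. square_integrable M (F k)"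
    and g: "square_integrable M g" "\<And>k. square_integrable M (G k)"
    and lim: "(\<lambda>k. LINT x|M. (norm (F k x - f x))\<^sup>2) \<longlonglongrightarrow> 0"
      "(\<lambda>k. LINT x|M. (norm (G k x - g x))\<^sup>2) \<longlonglongrightarrow> 0"
  shows "(\<lambda>k. LINT x|M. (norm ((F k x - G k x) - (f x - g x)))\<^sup>2) \<longlonglongrightarrow> 0"
proof (rule tendsto_sandwich[OF _ _ tendsto_const])
  show "(\<lambda>k. 2 * (LINT x|M. (norm (F k x - f x))\<^sup>2) + 2 * (LINT x|M. (norm (G k x - g x))\<^sup>2)) \<longlonglongrightarrow> 0"
    using tendsto_add[OF tendsto_mult[OF tendsto_const lim(1)] tendsto_mult[OF tendsto_const lim(2)], of 2 2] by simp
  show "\<forall>\<^sub>F k in sequentially. (LINT x|M. (norm ((F k x - G k x) - (f x - g x)))\<^sup>2)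
      \<le> 2 * (LINT x|M. (norm (F k x - f x))\<^sup>2) + 2 * (LINT x|M. (norm (G k x - g x))\<^sup>2)"
  proof (intro always_eventually allI)
    fix k
    have i: "integrable M (\<lambda>x. (norm (F k x - f x))\<^sup>2)" "integrable M (\<lambda>x. (norm (G k x - g x))\<^sup>2)"
      "integrable M (\<lambda>x. (norm ((F k x - G k x) - (f x - g x)))\<^sup>2)"
      using square_integrable_diff[OF f(2,1)] square_integrable_diff[OF g(2,1)]
        square_integrable_diff[OF square_integrable_diff[OF f(2) g(2)] square_integrable_diff[OF f(1) g(1)]]
      by (auto simp: square_integrable_def)
    have "(LINT x|M. (norm ((F k x - G k x) - (f x - g x)))\<^sup>2)
        \<le> (LINT x|M. 2 * (norm (F k x - f x))\<^sup>2 + 2 * (norm (G k x - g x))\<^sup>2)"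
    proof (rule integral_mono)
      fix x
      have "(F k x - G k x) - (f x - g x) = (F k x - f x) - (G k x - g x)" by (simp add: algebra_simps)
      then show "(norm ((F k x - G k x) - (f x - g x)))\<^sup>2 \<le> 2 * (norm (F k x - f x))\<^sup>2 + 2 * (norm (G k x - g x))\<^sup>2"
        by (metis norm_diff_square_le)
    qed (use i in auto)
    then show "(LINT x|M. (norm ((F k x - G k x) - (f x - g x)))\<^sup>2)
        \<le> 2 * (LINT x|M. (norm (F k x - f x))\<^sup>2) + 2 * (LINT x|M. (norm (G k x - g x))\<^sup>2)"
      using i by simp
  qed
qed simp

text \<open>The approximation clause of \<^const>\<open>has_trace\<close>; membership in the Sobolev space follows
  from it.\<close>

definition C1_approx where
  "C1_approx \<phi> u G h \<longleftrightarrow> (\<forall>k::nat. C1 (\<phi> k)) \<and>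
        (\<lambda>k. LINT x|disk_measure. (norm (\<phi> k x - u x))\<^sup>2) \<longlonglongrightarrow> 0 \<and>
        (\<lambda>k. LINT x|disk_measure. (norm (grad (\<phi> k) x - G x))\<^sup>2) \<longlonglongrightarrow> 0 \<and>
        (\<lambda>k. LINT t|angle_measure. (norm (\<phi> k (cos t, sin t) - h t))\<^sup>2) \<longlonglongrightarrow> 0"

text \<open>All of \<open>has_trace\<close> except the weak-gradient identity and the periodicity of
  h. Closure under differences and conjugation can be checked on the approximating sequences
  alone.\<close>

definition C1_limit where
  "C1_limit u G h \<longleftrightarrow> square_integrable disk_measure u \<and> square_integrable disk_measure G \<and>
     square_integrable angle_measure h \<and> (\<exists>\<phi>. C1_approx \<phi> u G h)"

lemma C1_limit_C1:
  assumes "C1 \<phi>"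
  shows "C1_limit \<phi> (grad \<phi>) (\<lambda>t. \<phi> (cos t, sin t))"
proof -
  have "C1_approx (\<lambda>_. \<phi>) \<phi> (grad \<phi>) (\<lambda>t. \<phi> (cos t, sin t))"
    using assms by (simp add: C1_approx_def)
  then show ?thesis
    unfolding C1_limit_def
    using continuous_square_integrable_disk[OF C1D(1)[OF assms]]
      continuous_square_integrable_disk[OF grad_continuous[OF assms]]
      continuous_square_integrable_angle[OF C1D(1)[OF assms]] by blast
qed

section \<open>Differences and conjugates of functions with a trace\<close>

lemma C1_has_derivative:
  assumes "C1 \<phi>"
  shows "(\<phi> has_derivative (\<lambda>h. fst h *\<^sub>R fst (grad \<phi> p) + snd h *\<^sub>R snd (grad \<phi> p))) (at p)"
proof -
  have f: "(\<phi> has_derivative frechet_derivative \<phi> (at p)) (at p)"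
    using assms frechet_derivative_works unfolding C1_iff by blast
  then have lin: "linear (frechet_derivative \<phi> (at p))"
    using has_derivative_linear by blast
  have "frechet_derivative \<phi> (at p) = (\<lambda>h. fst h *\<^sub>R fst (grad \<phi> p) + snd h *\<^sub>R snd (grad \<phi> p))"
  proof
    fix h :: plane
    have "h = fst h *\<^sub>R (1, 0) + snd h *\<^sub>R (0, 1)" by (simp add: prod_eq_iff)
    then have "frechet_derivative \<phi> (at p) h = frechet_derivative \<phi> (at p) (fst h *\<^sub>R (1, 0) + snd h *\<^sub>R (0, 1))"
      by simp
    also have "\<dots> = fst h *\<^sub>R fst (grad \<phi> p) + snd h *\<^sub>R snd (grad \<phi> p)"
      by (simp only: linear_add[OF lin] linear_scale[OF lin] grad_def fst_conv snd_conv)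
    finally show "frechet_derivative \<phi> (at p) h = fst h *\<^sub>R fst (grad \<phi> p) + snd h *\<^sub>R snd (grad \<phi> p)" .
  qed
  then show ?thesis using f by simp
qed

lemma C1_diff:
  assumes "C1 \<phi>" "C1 \<psi>"
  shows "C1 (\<lambda>p. \<phi> p - \<psi> p)" "grad (\<lambda>p. \<phi> p - \<psi> p) = (\<lambda>p. grad \<phi> p - grad \<psi> p)"
proof -
  have d: "((\<lambda>p. \<phi> p - \<psi> p) has_derivative (\<lambda>h. fst h *\<^sub>R (fst (grad \<phi> p) - fst (grad \<psi> p)) + snd h *\<^sub>R (snd (grad \<phi> p) - snd (grad \<psi> p)))) (at p)" for p
    using has_derivative_diff[OF C1_has_derivative[OF assms(1), of p] C1_has_derivative[OF assms(2), of p]]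
    by (simp add: algebra_simps)
  note c = continuous_on_diff[OF C1D(2)[OF assms(1)] C1D(2)[OF assms(2)]]
    continuous_on_diff[OF C1D(3)[OF assms(1)] C1D(3)[OF assms(2)]]
  show "C1 (\<lambda>p. \<phi> p - \<psi> p)" by (rule C1I(1)[OF d c])
  show "grad (\<lambda>p. \<phi> p - \<psi> p) = (\<lambda>p. grad \<phi> p - grad \<psi> p)"
    unfolding C1I(2)[OF d c] by (auto simp: prod_eq_iff)
qed

text \<open>\<open>energy_form\<close> is bilinear rather than sesquilinear, so a square norm
  appears only when a function is tested against its conjugate, whose gradient is the conjugate
  pair.\<close>

definition cnj_pair :: "complex \<times> complex \<Rightarrow> complex \<times> complex" where
  "cnj_pair z = (cnj (fst z), cnj (snd z))"

lemma norm_cnj_pair: "norm (cnj_pair z) = norm z"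
  by (simp add: cnj_pair_def norm_prod_def)

lemma bounded_linear_cnj_pair: "bounded_linear cnj_pair"
  unfolding cnj_pair_def[abs_def]
  by (intro bounded_linear_Pair bounded_linear_compose[OF bounded_linear_cnj] bounded_linear_fst bounded_linear_snd)

lemma C1_cnj:
  assumes "C1 \<phi>"
  shows "C1 (\<lambda>p. cnj (\<phi> p))" "grad (\<lambda>p. cnj (\<phi> p)) = (\<lambda>p. cnj_pair (grad \<phi> p))"
proof -
  have d: "((\<lambda>p. cnj (\<phi> p)) has_derivative (\<lambda>h. fst h *\<^sub>R cnj (fst (grad \<phi> p)) + snd h *\<^sub>R cnj (snd (grad \<phi> p)))) (at p)" for p
    using bounded_linear.has_derivative[OF bounded_linear_cnj C1_has_derivative[OF assms, of p]]
    by simp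
  note c = continuous_on_cnj[OF C1D(2)[OF assms]] continuous_on_cnj[OF C1D(3)[OF assms]]
  show "C1 (\<lambda>p. cnj (\<phi> p))" by (rule C1I(1)[OF d c])
  show "grad (\<lambda>p. cnj (\<phi> p)) = (\<lambda>p. cnj_pair (grad \<phi> p))"
    unfolding C1I(2)[OF d c] by (simp add: cnj_pair_def)
qed

lemma C1_approx_square_integrable:
  assumes "C1_approx \<phi> u G h"
  shows "square_integrable disk_measure (\<phi> k)" "square_integrable disk_measure (grad (\<phi> k))"
    "square_integrable angle_measure (\<lambda>t. \<phi> k (cos t, sin t))"
  using C1_limit_C1[of "\<phi> k"] assms by (auto simp: C1_approx_def C1_limit_def)

lemma C1_limit_diff:
  assumes "C1_limit u G h" "C1_limit v H k"
  shows "C1_limit (\<lambda>x. u x - v x) (\<lambda>x. G x - H x) (\<lambda>t. h t - k t)"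
proof -
  obtain \<phi> \<psi> where a: "C1_approx \<phi> u G h" and c: "C1_approx \<psi> v H k"
    using assms by (auto simp: C1_limit_def)
  have "C1_approx (\<lambda>n p. \<phi> n p - \<psi> n p) (\<lambda>x. u x - v x) (\<lambda>x. G x - H x) (\<lambda>t. h t - k t)"
    using assms a c C1_approx_square_integrable[OF a] C1_approx_square_integrable[OF c]
    unfolding C1_approx_def C1_limit_def
    by (auto simp: C1_diff intro!: L2_tendsto_diff)
  then show ?thesis
    using assms unfolding C1_limit_def by (auto intro: square_integrable_diff)
qed

lemma C1_limit_cnj:
  assumes "C1_limit u G h"
  shows "C1_limit (\<lambda>x. cnj (u x)) (\<lambda>x. cnj_pair (G x)) (\<lambda>t. cnj (h t))"
proof -
  obtain \<phi> where a: "C1_approx \<phi> u G h" using assms by (auto simp: C1_limit_def)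
  have "C1_approx (\<lambda>n p. cnj (\<phi> n p)) (\<lambda>x. cnj (u x)) (\<lambda>x. cnj_pair (G x)) (\<lambda>t. cnj (h t))"
    unfolding C1_approx_def
  proof (intro conjI allI)
    note sq = C1_approx_square_integrable[OF a]
    note u = assms[unfolded C1_limit_def] and l = a[unfolded C1_approx_def]
    show "C1 (\<lambda>p. cnj (\<phi> k p))" for k using l by (intro C1_cnj(1)) auto
    show "(\<lambda>k. LINT x|disk_measure. (norm (cnj (\<phi> k x) - cnj (u x)))\<^sup>2) \<longlonglongrightarrow> 0"
      by (rule L2_tendsto_dominated[OF _ sq(1) bounded_linear_cnj]) (use u l in auto)
    have "grad (\<lambda>p. cnj (\<phi> k p)) = (\<lambda>p. cnj_pair (grad (\<phi> k) p))" for k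
      using l by (intro C1_cnj(2)) auto
    then show "(\<lambda>k. LINT x|disk_measure. (norm (grad (\<lambda>p. cnj (\<phi> k p)) x - cnj_pair (G x)))\<^sup>2) \<longlonglongrightarrow> 0"
      using L2_tendsto_dominated[OF _ sq(2) bounded_linear_cnj_pair, of G] u l by (simp add: norm_cnj_pair)
    show "(\<lambda>k. LINT t|angle_measure. (norm (cnj (\<phi> k (cos t, sin t)) - cnj (h t)))\<^sup>2) \<longlonglongrightarrow> 0"
      by (rule L2_tendsto_dominated[OF _ sq(3) bounded_linear_cnj]) (use u l in auto)
  qed
  moreover have "cnj_pair \<in> borel_measurable borel"
    by (intro borel_measurable_continuous_onI linear_continuous_on bounded_linear_cnj_pair)
  moreover have "cnj \<in> borel_measurable borel"
    by (intro borel_measurable_continuous_onI linear_continuous_on bounded_linear_cnj)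
  ultimately show ?thesis
    using assms unfolding C1_limit_def square_integrable_def
    by (auto simp: norm_cnj_pair intro: measurable_compose)
qed

section \<open>Green's formula for products, for C1 functions and their limits\<close>

lemma C1_product_derivative:
  assumes "(p has_vector_derivative p') (at x)" "(f has_vector_derivative f') (at x)" "(g has_vector_derivative g') (at x)"
  shows "((\<lambda>x. p x * f x * g x :: complex) has_vector_derivative p' * f x * g x + (p x * f' * g x + p x * f x * g')) (at x)"
  using has_vector_derivative_mult[OF has_vector_derivative_mult[OF assms(1,2)] assms(3)]
  by (simp add: algebra_simps)

lemma norm_fst_le': "norm (fst z) \<le> norm z" and norm_snd_le': "norm (snd z) \<le> norm z"
  by (metis norm_fst_le prod.collapse, metis norm_snd_le prod.collapse)

lemma square_integrable_fst_snd:
  assumes "square_integrable M G"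
  shows "square_integrable M (\<lambda>x. fst (G x))" "square_integrable M (\<lambda>x. snd (G x))"
proof -
  have [measurable]: "G \<in> borel_measurable M" using assms by (simp add: square_integrable_def)
  have "(\<lambda>x. fst (G x)) \<in> borel_measurable M" "(\<lambda>x. snd (G x)) \<in> borel_measurable M"
    by (rule borel_measurable_continuous_on[OF _ \<open>G \<in> _\<close>], intro continuous_intros)+
  then show "square_integrable M (\<lambda>x. fst (G x))" "square_integrable M (\<lambda>x. snd (G x))"
    by (auto intro!: square_integrable_dominated[OF assms] norm_fst_le' norm_snd_le')
qed

lemma C1_approx_fst_snd:
  assumes "C1_approx \<phi> u G h" "square_integrable disk_measure G"
  shows "(\<lambda>k. LINT x|disk_measure. (norm (fst (grad (\<phi> k) x) - fst (G x)))\<^sup>2) \<longlonglongrightarrow> 0"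
    and "(\<lambda>k. LINT x|disk_measure. (norm (snd (grad (\<phi> k) x) - snd (G x)))\<^sup>2) \<longlonglongrightarrow> 0"
  using assms(1) L2_tendsto_dominated[OF assms(2) C1_approx_square_integrable(2)[OF assms(1)] bounded_linear_fst norm_fst_le']
    L2_tendsto_dominated[OF assms(2) C1_approx_square_integrable(2)[OF assms(1)] bounded_linear_snd norm_snd_le']
  by (simp_all add: C1_approx_def)

lemma continuous_weight_disk:
  fixes m :: "plane \<Rightarrow> complex"
  assumes "continuous_on UNIV m"
  shows "m \<in> borel_measurable disk_measure" "\<exists>B. AE x in disk_measure. norm (m x) \<le> B"
proof -
  obtain B where "\<And>p. p \<in> unit_disk \<Longrightarrow> norm (m p) \<le> B"
    using continuous_bounded_disk[OF assms] by blast
  then show "\<exists>B. AE x in disk_measure. norm (m x) \<le> B"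
    by (intro exI[of _ B] AE_I2) auto
  show "m \<in> borel_measurable disk_measure"
    by (intro borel_measurable_disk borel_measurable_continuous_onI assms)
qed

lemma continuous_weight_angle:
  fixes m :: "plane \<Rightarrow> complex"
  assumes "continuous_on UNIV m"
  shows "(\<lambda>t. m (cos t, sin t)) \<in> borel_measurable angle_measure"
    "\<exists>B. AE t in angle_measure. norm (m (cos t, sin t)) \<le> B"
proof -
  obtain B where "\<And>t. norm (m (cos t, sin t)) \<le> B"
    using continuous_bounded_disk[OF assms] by blast
  then show "\<exists>B. AE t in angle_measure. norm (m (cos t, sin t)) \<le> B"
    by (intro exI[of _ B] AE_I2) auto
  show "(\<lambda>t. m (cos t, sin t)) \<in> borel_measurable angle_measure"
    using continuous_square_integrable_angle[OF assms] by (simp add: square_integrable_def)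
qed

lemma continuous_mult_square_integrable:
  fixes m f g :: "plane \<Rightarrow> complex"
  assumes "continuous_on UNIV m" "square_integrable disk_measure f" "square_integrable disk_measure g"
  shows "integrable disk_measure (\<lambda>x. m x * f x * g x)"
proof -
  obtain B where "AE x in disk_measure. norm (m x) \<le> B" using continuous_weight_disk(2)[OF assms(1)] ..
  then show ?thesis
    by (rule square_integrable_integrable_mult[OF assms(2,3) continuous_weight_disk(1)[OF assms(1)]])
qed

lemma continuous_weight_L2_tendsto:
  fixes m f g :: "plane \<Rightarrow> complex"
  assumes "continuous_on UNIV m" "square_integrable disk_measure f" "square_integrable disk_measure g"
    "\<And>k. square_integrable disk_measure (F k)" "\<And>k. square_integrable disk_measure (G k)"
    "(\<lambda>k. LINT x|disk_measure. (norm (F k x - f x))\<^sup>2) \<longlonglongrightarrow> 0"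
    "(\<lambda>k. LINT x|disk_measure. (norm (G k x - g x))\<^sup>2) \<longlonglongrightarrow> 0"
  shows "(\<lambda>k. LINT x|disk_measure. m x * F k x * G k x) \<longlonglongrightarrow> (LINT x|disk_measure. m x * f x * g x)"
proof -
  obtain B where "AE x in disk_measure. norm (m x) \<le> B" using continuous_weight_disk(2)[OF assms(1)] ..
  then show ?thesis
    by (rule L2_mult_tendsto[OF assms(2-5) continuous_weight_disk(1)[OF assms(1)] _ assms(6,7)])
qed

lemma continuous_bounded_measurable_disk:
  assumes "continuous_on UNIV D"
  shows "D \<in> borel_measurable borel" "\<exists>B. \<forall>p\<in>unit_disk. norm (D p :: complex) \<le> B"
  using continuous_bounded_disk[OF assms] borel_measurable_continuous_onI[OF assms] by blast+

text \<open>The divergence theorem applied to the product p f g. Keeping a third factor p lets one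
  formula serve both for test functions, which verify weak gradients, and for the coordinate
  functions, which yield positivity of the energy form.\<close>

lemma C1_green:
  assumes p: "C1 p" and f: "C1 f" and g: "C1 g"
  shows "(LINT x|disk_measure. fst (grad p x) * f x * g x) + ((LINT x|disk_measure. p x * fst (grad f x) * g x)
      + (LINT x|disk_measure. p x * f x * fst (grad g x)))
    = (LINT t|angle_measure. (of_real (cos t) * p (cos t, sin t)) * f (cos t, sin t) * g (cos t, sin t))" (is ?x)
  and "(LINT x|disk_measure. snd (grad p x) * f x * g x) + ((LINT x|disk_measure. p x * snd (grad f x) * g x)
      + (LINT x|disk_measure. p x * f x * snd (grad g x)))
    = (LINT t|angle_measure. (of_real (sin t) * p (cos t, sin t)) * f (cos t, sin t) * g (cos t, sin t))" (is ?y)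
proof -
  note c = C1D(1-3)[OF p] C1D(1-3)[OF f] C1D(1-3)[OF g]
  note i = continuous_mult_square_integrable continuous_square_integrable_disk c
  have cF: "continuous_on UNIV (\<lambda>x. p x * f x * g x)" by (intro continuous_intros c)
  let ?D = "\<lambda>x. fst (grad p x) * f x * g x + (p x * fst (grad f x) * g x + p x * f x * fst (grad g x))"
  have cD: "continuous_on UNIV ?D" by (intro continuous_intros c)
  obtain B where B: "\<And>x. x \<in> unit_disk \<Longrightarrow> norm (?D x) \<le> B" using continuous_bounded_measurable_disk(2)[OF cD] by blast
  have "(LINT x|disk_measure. ?D x) = (LINT t|angle_measure. of_real (cos t) * (p (cos t, sin t) * f (cos t, sin t) * g (cos t, sin t)))"
    by (rule green_disk_x[OF cF continuous_bounded_measurable_disk(1)[OF cD] B, of "\<lambda>_. {}"])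
       (auto intro!: C1_product_derivative C1D(4) p f g)
  moreover have "(LINT x|disk_measure. ?D x) = (LINT x|disk_measure. fst (grad p x) * f x * g x) + ((LINT x|disk_measure. p x * fst (grad f x) * g x)
      + (LINT x|disk_measure. p x * f x * fst (grad g x)))"
    by (simp add: i)
  ultimately show ?x by (simp add: mult.assoc)
  let ?D = "\<lambda>x. snd (grad p x) * f x * g x + (p x * snd (grad f x) * g x + p x * f x * snd (grad g x))"
  have cD: "continuous_on UNIV ?D" by (intro continuous_intros c)
  obtain B where B: "\<And>x. x \<in> unit_disk \<Longrightarrow> norm (?D x) \<le> B" using continuous_bounded_measurable_disk(2)[OF cD] by blast
  have "(LINT x|disk_measure. ?D x) = (LINT t|angle_measure. of_real (sin t) * (p (cos t, sin t) * f (cos t, sin t) * g (cos t, sin t)))"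
    by (rule green_disk_y[OF cF continuous_bounded_measurable_disk(1)[OF cD] B, of "\<lambda>_. {}"])
       (auto intro!: C1_product_derivative C1D(5) p f g)
  moreover have "(LINT x|disk_measure. ?D x) = (LINT x|disk_measure. snd (grad p x) * f x * g x) + ((LINT x|disk_measure. p x * snd (grad f x) * g x)
      + (LINT x|disk_measure. p x * f x * snd (grad g x)))"
    by (simp add: i)
  ultimately show ?y by (simp add: mult.assoc)
qed

text \<open>Every term is the integral of two square-mean convergent sequences against a fixed
  bounded weight built from p and its gradient, hence passes to the limit. The factor p stays C1 so
  that these weights are bounded on the disk.\<close>

lemma C1_limit_green:
  assumes u: "C1_limit u G h" and v: "C1_limit v H k" and p: "C1 p"
  shows "(LINT x|disk_measure. fst (grad p x) * u x * v x) + ((LINT x|disk_measure. p x * fst (G x) * v x)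
      + (LINT x|disk_measure. p x * u x * fst (H x)))
    = (LINT t|angle_measure. (of_real (cos t) * p (cos t, sin t)) * h t * k t)" (is ?x)
  and "(LINT x|disk_measure. snd (grad p x) * u x * v x) + ((LINT x|disk_measure. p x * snd (G x) * v x)
      + (LINT x|disk_measure. p x * u x * snd (H x)))
    = (LINT t|angle_measure. (of_real (sin t) * p (cos t, sin t)) * h t * k t)" (is ?y)
proof -
  obtain \<phi> \<psi> where a: "C1_approx \<phi> u G h" and c: "C1_approx \<psi> v H k"
    using u v by (auto simp: C1_limit_def)
  have C: "C1 (\<phi> n)" "C1 (\<psi> n)" for n using a c by (auto simp: C1_approx_def)
  note sq = C1_approx_square_integrable[OF a] C1_approx_square_integrable[OF c]
  have su: "square_integrable disk_measure u" "square_integrable disk_measure G" "square_integrable angle_measure h"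
    "square_integrable disk_measure v" "square_integrable disk_measure H" "square_integrable angle_measure k"
    using u v by (auto simp: C1_limit_def)
  note lims = a[unfolded C1_approx_def, THEN conjunct2] c[unfolded C1_approx_def, THEN conjunct2]
  have lim: "(\<lambda>n. LINT x|disk_measure. (norm (\<phi> n x - u x))\<^sup>2) \<longlonglongrightarrow> 0"
    "(\<lambda>n. LINT x|disk_measure. (norm (\<psi> n x - v x))\<^sup>2) \<longlonglongrightarrow> 0"
    "(\<lambda>n. LINT t|angle_measure. (norm (\<phi> n (cos t, sin t) - h t))\<^sup>2) \<longlonglongrightarrow> 0"
    "(\<lambda>n. LINT t|angle_measure. (norm (\<psi> n (cos t, sin t) - k t))\<^sup>2) \<longlonglongrightarrow> 0"
    using lims by auto
  note all = C1D(1-3)[OF p] square_integrable_fst_snd su sq lim C1_approx_fst_snd[OF a su(2)] C1_approx_fst_snd[OF c su(5)]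
  \<comment> \<open>The weights cos t and sin t are restrictions of the coordinate functions to the
    circle; stating the weight as a continuous function on the plane makes it bounded there.\<close>
  have bd: "(\<lambda>n. LINT t|angle_measure. m (cos t, sin t) * \<phi> n (cos t, sin t) * \<psi> n (cos t, sin t))
     \<longlonglongrightarrow> (LINT t|angle_measure. m (cos t, sin t) * h t * k t)" if m: "continuous_on UNIV m" for m :: "plane \<Rightarrow> complex"
  proof -
    obtain B where "AE t in angle_measure. norm (m (cos t, sin t)) \<le> B" using continuous_weight_angle(2)[OF m] ..
    then show ?thesis
      by (rule L2_mult_tendsto[OF su(3) su(6) sq(3) sq(6) continuous_weight_angle(1)[OF m] _ lim(3,4)])
  qed
  have "(\<lambda>n. (LINT x|disk_measure. fst (grad p x) * \<phi> n x * \<psi> n x) + ((LINT x|disk_measure. p x * fst (grad (\<phi> n) x) * \<psi> n x)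
      + (LINT x|disk_measure. p x * \<phi> n x * fst (grad (\<psi> n) x)))) \<longlonglongrightarrow>
      (LINT x|disk_measure. fst (grad p x) * u x * v x) + ((LINT x|disk_measure. p x * fst (G x) * v x)
      + (LINT x|disk_measure. p x * u x * fst (H x)))"
    by (intro tendsto_add continuous_weight_L2_tendsto all)
  then show ?x
    unfolding C1_green(1)[OF p C]
    by (rule LIMSEQ_unique) (use bd[of "\<lambda>x. of_real (fst x) * p x"] all in \<open>simp add: continuous_intros\<close>)
  have "(\<lambda>n. (LINT x|disk_measure. snd (grad p x) * \<phi> n x * \<psi> n x) + ((LINT x|disk_measure. p x * snd (grad (\<phi> n) x) * \<psi> n x)
      + (LINT x|disk_measure. p x * \<phi> n x * snd (grad (\<psi> n) x)))) \<longlonglongrightarrow>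
      (LINT x|disk_measure. snd (grad p x) * u x * v x) + ((LINT x|disk_measure. p x * snd (G x) * v x)
      + (LINT x|disk_measure. p x * u x * snd (H x)))"
    by (intro tendsto_add continuous_weight_L2_tendsto all)
  then show ?y
    unfolding C1_green(2)[OF p C]
    by (rule LIMSEQ_unique) (use bd[of "\<lambda>x. of_real (snd x) * p x"] all in \<open>simp add: continuous_intros\<close>)
qed

lemma C1_const: "C1 (\<lambda>_. c)" "grad (\<lambda>_. c) = (\<lambda>_. 0)"
proof -
  have d: "((\<lambda>_. c) has_derivative (\<lambda>h. fst h *\<^sub>R 0 + snd h *\<^sub>R 0)) (at p)" for p :: plane by simp
  show "C1 (\<lambda>_. c)" by (rule C1I(1)[OF d]) auto
  show "grad (\<lambda>_. c) = (\<lambda>_. 0)" by (subst C1I(2)[OF d]) (auto simp: zero_prod_def)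
qed

text \<open>Approximation by C1 functions already forces the weak-gradient identity: in Green's
  formula the second function is taken to be 1 and p a test function, whose support is a compact
  subset of the open disk and so misses the circle.\<close>

lemma has_trace_iff: "has_trace u G h \<longleftrightarrow> C1_limit u G h \<and> periodic_L2 h"
proof
  assume "has_trace u G h"
  then show "C1_limit u G h \<and> periodic_L2 h"
    by (auto simp: has_trace_def C1_limit_def C1_approx_def C1_def H1_def periodic_L2_def)
next
  assume a: "C1_limit u G h \<and> periodic_L2 h"
  then have u: "C1_limit u G h" by simp
  have sq: "square_integrable disk_measure u" "square_integrable disk_measure G"
    using u by (auto simp: C1_limit_def)
  have "H1 u G"
    unfolding H1_def
  proof (intro conjI allI impI sq)
    fix \<phi> assume t: "test_function \<phi>"
    have C: "C1 \<phi>" using t by (simp add: test_function_def C1_def)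
    obtain K where K: "K \<subseteq> unit_disk" "\<And>x. x \<notin> K \<Longrightarrow> \<phi> x = 0"
      using t by (auto simp: test_function_def)
    have z: "\<phi> (cos t, sin t) = 0" for t
      using K(1) by (intro K(2)) (auto simp: mem_unit_disk dest!: subsetD)
    have one: "C1_limit (\<lambda>_. 1) (\<lambda>_. 0) (\<lambda>_. 1)"
      using C1_limit_C1[OF C1_const(1)[of 1]] by (simp add: C1_const(2))
    show "(LINT x|disk_measure. u x * fst (grad \<phi> x)) = - (LINT x|disk_measure. fst (G x) * \<phi> x)"
      using C1_limit_green(1)[OF u one C] by (simp add: z mult.commute add_eq_0_iff)
    show "(LINT x|disk_measure. u x * snd (grad \<phi> x)) = - (LINT x|disk_measure. snd (G x) * \<phi> x)"
      using C1_limit_green(2)[OF u one C] by (simp add: z mult.commute add_eq_0_iff)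
  qed
  then show "has_trace u G h"
    using a by (auto simp: has_trace_def C1_limit_def C1_approx_def C1_def)
qed


subsection \<open>Uniqueness of the weak solution\<close>

lemma energy_form_integrable:
  fixes u v :: "plane \<Rightarrow> complex" and G H :: "plane \<Rightarrow> complex \<times> complex"
  assumes u: "square_integrable disk_measure u" "square_integrable disk_measure G"
    and v: "square_integrable disk_measure v" "square_integrable disk_measure H"
    and q: "q \<in> borel_measurable disk_measure" "AE x in disk_measure. \<bar>q x\<bar> \<le> B"
  shows "integrable disk_measure (\<lambda>x. fst (G x) * fst (H x))"
    "integrable disk_measure (\<lambda>x. snd (G x) * snd (H x))"
    "integrable disk_measure (\<lambda>x. of_real (q x) * u x * v x)"
proof -
  show "integrable disk_measure (\<lambda>x. fst (G x) * fst (H x))"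
    using continuous_mult_square_integrable[of "\<lambda>_. 1", OF _ square_integrable_fst_snd(1)[OF u(2)] square_integrable_fst_snd(1)[OF v(2)]] by simp
  show "integrable disk_measure (\<lambda>x. snd (G x) * snd (H x))"
    using continuous_mult_square_integrable[of "\<lambda>_. 1", OF _ square_integrable_fst_snd(2)[OF u(2)] square_integrable_fst_snd(2)[OF v(2)]] by simp
  show "integrable disk_measure (\<lambda>x. of_real (q x) * u x * v x)"
    by (rule square_integrable_integrable_mult[OF u(1) v(1), of _ B]) (use q in auto)
qed

lemma energy_form_eq:
  assumes u: "square_integrable disk_measure u" "square_integrable disk_measure G"
    and v: "square_integrable disk_measure v" "square_integrable disk_measure H"
    and q: "q \<in> borel_measurable disk_measure" "AE x in disk_measure. \<bar>q x\<bar> \<le> B"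
  shows "energy_form q u G v H = (LINT x|disk_measure. fst (G x) * fst (H x))
    + (LINT x|disk_measure. snd (G x) * snd (H x)) - (LINT x|disk_measure. of_real (q x) * u x * v x)"
  unfolding energy_form_def using energy_form_integrable[OF assms] by simp

text \<open>These are the weights p = x and p = y of Green's formula in the positivity
  argument.\<close>

lemma coordinate_C1:
  "C1 (\<lambda>x. of_real (fst x))" "grad (\<lambda>x. of_real (fst x)) = (\<lambda>_. (1, 0))"
  "C1 (\<lambda>x. of_real (snd x))" "grad (\<lambda>x. of_real (snd x)) = (\<lambda>_. (0, 1))"
proof -
  have d1: "((\<lambda>x. of_real (fst x)) has_derivative (\<lambda>h. fst h *\<^sub>R (1::complex) + snd h *\<^sub>R 0)) (at p)" for p :: plane
    by (auto intro!: derivative_eq_intros simp: scaleR_conv_of_real)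
  have d2: "((\<lambda>x. of_real (snd x)) has_derivative (\<lambda>h. fst h *\<^sub>R (0::complex) + snd h *\<^sub>R 1)) (at p)" for p :: plane
    by (auto intro!: derivative_eq_intros simp: scaleR_conv_of_real)
  show "C1 (\<lambda>x. of_real (fst x))" "C1 (\<lambda>x. of_real (snd x))"
    by (rule C1I(1)[OF d1], auto) (rule C1I(1)[OF d2], auto)
  show "grad (\<lambda>x. of_real (fst x)) = (\<lambda>_. (1, 0))" by (rule C1I(2)[OF d1]) auto
  show "grad (\<lambda>x. of_real (snd x)) = (\<lambda>_. (0, 1))" by (rule C1I(2)[OF d2]) auto
qed

text \<open>Completing the square, \<open>\<integral>|W|\<^sup>2 = \<integral>|W + x w|\<^sup>2 + \<integral>(2 - |x|\<^sup>2) |w|\<^sup>2\<close> for zero trace,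
  so the form is positive as soon as \<open>q \<le> 1\<close>, without any eigenvalue estimate.\<close>

lemma zero_trace_energy_zero:
  assumes w: "C1_limit w W (\<lambda>t. 0)"
    and q: "q \<in> borel_measurable disk_measure" "AE x in disk_measure. 0 \<le> q x \<and> q x \<le> 1"
    and e: "energy_form q w W (\<lambda>x. cnj (w x)) (\<lambda>x. cnj_pair (W x)) = 0"
  shows "AE x in disk_measure. w x = 0 \<and> W x = 0"
proof -
  have w': "C1_limit (\<lambda>x. cnj (w x)) (\<lambda>x. cnj_pair (W x)) (\<lambda>t. 0)"
    using C1_limit_cnj[OF w] by simp
  have sq: "square_integrable disk_measure w" "square_integrable disk_measure W"
    "square_integrable disk_measure (\<lambda>x. cnj (w x))" "square_integrable disk_measure (\<lambda>x. cnj_pair (W x))"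
    using w w' by (auto simp: C1_limit_def)
  have qB: "AE x in disk_measure. \<bar>q x\<bar> \<le> 1" using q(2) by eventually_elim auto
  note ei = energy_form_integrable[OF sq q(1) qB]
  note ci = continuous_mult_square_integrable continuous_intros square_integrable_fst_snd sq
  \<comment> \<open>The completed square. The 2 is the divergence of the position field in the
    plane; expanding R gives the integrand of the energy plus those of the two Green identities
    below, so its integral is 0. For q \<le> 1 the last coefficient is positive in the open
    disk.\<close>
  define R where "R x = (cmod (fst (W x) + of_real (fst x) * w x))\<^sup>2 + (cmod (snd (W x) + of_real (snd x) * w x))\<^sup>2
     + (2 - ((fst x)\<^sup>2 + (snd x)\<^sup>2) - q x) * (cmod (w x))\<^sup>2" for x
  let ?T1 = "\<lambda>x. 1 * w x * cnj (w x)"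
  let ?T2 = "\<lambda>x. of_real (fst x) * fst (W x) * cnj (w x)"
  let ?T3 = "\<lambda>x. of_real (fst x) * w x * fst (cnj_pair (W x))"
  let ?T4 = "\<lambda>x. of_real (snd x) * snd (W x) * cnj (w x)"
  let ?T5 = "\<lambda>x. of_real (snd x) * w x * snd (cnj_pair (W x))"
  let ?E1 = "\<lambda>x. fst (W x) * fst (cnj_pair (W x))"
  let ?E2 = "\<lambda>x. snd (W x) * snd (cnj_pair (W x))"
  let ?E3 = "\<lambda>x. of_real (q x) * w x * cnj (w x)"
  have i: "integrable disk_measure ?T1" "integrable disk_measure ?T2" "integrable disk_measure ?T3"
    "integrable disk_measure ?T4" "integrable disk_measure ?T5"
    by (intro ci)+
  \<comment> \<open>Green's formula for |w|^2 with weight x; the boundary term vanishes with the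
    trace. The next identity is its counterpart for y.\<close>
  have g1: "(LINT x|disk_measure. ?T1 x) + ((LINT x|disk_measure. ?T2 x) + (LINT x|disk_measure. ?T3 x)) = 0"
    using C1_limit_green(1)[OF w w' coordinate_C1(1)] by (simp add: coordinate_C1)
  have g2: "(LINT x|disk_measure. ?T1 x) + ((LINT x|disk_measure. ?T4 x) + (LINT x|disk_measure. ?T5 x)) = 0"
    using C1_limit_green(2)[OF w w' coordinate_C1(3)] by (simp add: coordinate_C1)
  have e': "(LINT x|disk_measure. ?E1 x) + (LINT x|disk_measure. ?E2 x) - (LINT x|disk_measure. ?E3 x) = 0"
    using e unfolding energy_form_eq[OF sq q(1) qB] .
  have R: "complex_of_real (R x) = ((?T1 x + (?T2 x + ?T3 x)) + (?T1 x + (?T4 x + ?T5 x))) + ((?E1 x + ?E2 x) - ?E3 x)" for x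
    by (simp only: R_def of_real_add of_real_mult of_real_diff complex_norm_square cnj_pair_def fst_conv snd_conv
         complex_cnj_add complex_cnj_mult complex_cnj_complex_of_real)
       (simp add: algebra_simps power2_eq_square)
  have iR: "integrable disk_measure (\<lambda>x. complex_of_real (R x))"
    unfolding R by (intro Bochner_Integration.integrable_add Bochner_Integration.integrable_diff i ei)
  have "(LINT x|disk_measure. complex_of_real (R x)) =
     (((LINT x|disk_measure. ?T1 x) + ((LINT x|disk_measure. ?T2 x) + (LINT x|disk_measure. ?T3 x)))
     + ((LINT x|disk_measure. ?T1 x) + ((LINT x|disk_measure. ?T4 x) + (LINT x|disk_measure. ?T5 x))))
     + ((LINT x|disk_measure. ?E1 x) + (LINT x|disk_measure. ?E2 x) - (LINT x|disk_measure. ?E3 x))"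
    unfolding R using i ei by simp
  then have "(LINT x|disk_measure. complex_of_real (R x)) = 0" unfolding g1 g2 e' by simp
  then have R0: "(LINT x|disk_measure. R x) = 0" by simp
  have rad: "(fst x)\<^sup>2 + (snd x)\<^sup>2 < 1" if "x \<in> unit_disk" for x
    using that mem_unit_disk[of "fst x" "snd x"] by simp
  have disk: "AE x in disk_measure. x \<in> unit_disk" by (intro AE_I2) simp
  have nn: "AE x in disk_measure. 0 \<le> R x"
    using q(2) disk
  proof eventually_elim
    fix x assume x: "0 \<le> q x \<and> q x \<le> 1" "x \<in> unit_disk"
    have "0 \<le> 2 - ((fst x)\<^sup>2 + (snd x)\<^sup>2) - q x" using x rad[of x] by linarith
    then show "0 \<le> R x" unfolding R_def by simp
  qed
  have "integrable disk_measure R" using iR by (simp only: complex_of_real_integrable_eq)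
  then have "AE x in disk_measure. R x = 0"
    using integral_nonneg_eq_0_iff_AE[OF _ nn] R0 by simp
  then show ?thesis using q(2) disk
  proof eventually_elim
    fix x assume x: "R x = 0" "0 \<le> q x \<and> q x \<le> 1" "x \<in> unit_disk"
    have p: "0 < 2 - ((fst x)\<^sup>2 + (snd x)\<^sup>2) - q x" using x rad[of x] by linarith
    then have "(2 - ((fst x)\<^sup>2 + (snd x)\<^sup>2) - q x) * (cmod (w x))\<^sup>2 = 0"
      using x(1) unfolding R_def
      by (smt (verit) mult_nonneg_nonneg zero_le_power2)
    then have w0: "w x = 0" using p by simp
    then show "w x = 0 \<and> W x = 0"
      using x(1) by (simp add: R_def sum_power2_eq_zero_iff prod_eq_iff)
  qed
qed

text \<open>The difference of the solutions has zero trace, so its conjugate is an admissible test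
  function and the energy of the difference vanishes. Only the energies are compared because the
  solutions are determined up to null sets and the normal derivative sees nothing else.\<close>

lemma weak_solution_unique:
  assumes q: "q \<in> borel_measurable disk_measure" "AE x in disk_measure. 0 \<le> q x \<and> q x \<le> 1"
    and s: "weak_solution q g u G" "weak_solution q g u' G'"
    and v: "has_trace v H h"
  shows "energy_form q u G v H = energy_form q u' G' v H"
proof -
  have qB: "AE x in disk_measure. \<bar>q x\<bar> \<le> 1" using q(2) by eventually_elim auto
  have lim: "C1_limit u G g" "C1_limit u' G' g" "C1_limit v H h"
    using s v by (auto simp: weak_solution_def has_trace_iff)
  have sq: "square_integrable disk_measure u" "square_integrable disk_measure G"
    "square_integrable disk_measure u'" "square_integrable disk_measure G'"
    "square_integrable disk_measure v" "square_integrable disk_measure H"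
    using lim by (auto simp: C1_limit_def)
  have w: "C1_limit (\<lambda>x. u x - u' x) (\<lambda>x. G x - G' x) (\<lambda>t. 0)"
    using C1_limit_diff[OF lim(1,2)] by simp
  note sw = w[unfolded C1_limit_def, THEN conjunct1] w[unfolded C1_limit_def, THEN conjunct2, THEN conjunct1]
  have diff: "energy_form q (\<lambda>x. u x - u' x) (\<lambda>x. G x - G' x) z Z = energy_form q u G z Z - energy_form q u' G' z Z"
    if z: "square_integrable disk_measure z" "square_integrable disk_measure Z" for z Z
    unfolding energy_form_eq[OF sw z q(1) qB] energy_form_eq[OF sq(1,2) z q(1) qB] energy_form_eq[OF sq(3,4) z q(1) qB]
    using energy_form_integrable[OF sq(1,2) z q(1) qB] energy_form_integrable[OF sq(3,4) z q(1) qB]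
    by (simp add: left_diff_distrib right_diff_distrib)
  have w': "C1_limit (\<lambda>x. cnj (u x - u' x)) (\<lambda>x. cnj_pair (G x - G' x)) (\<lambda>t. 0)"
    using C1_limit_cnj[OF w] by simp
  then have "has_trace (\<lambda>x. cnj (u x - u' x)) (\<lambda>x. cnj_pair (G x - G' x)) (\<lambda>t. 0)"
    by (simp add: has_trace_iff periodic_L2_def C1_limit_def)
  moreover have "square_integrable disk_measure (\<lambda>x. cnj (u x - u' x))"
    "square_integrable disk_measure (\<lambda>x. cnj_pair (G x - G' x))"
    using w' by (auto simp: C1_limit_def)
  ultimately have "energy_form q (\<lambda>x. u x - u' x) (\<lambda>x. G x - G' x) (\<lambda>x. cnj (u x - u' x)) (\<lambda>x. cnj_pair (G x - G' x)) = 0"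
    using s diff by (simp add: weak_solution_def)
  from zero_trace_energy_zero[OF w q this]
  have ae: "AE x in disk_measure. u x - u' x = 0 \<and> G x - G' x = 0" .
  have "energy_form q (\<lambda>x. u x - u' x) (\<lambda>x. G x - G' x) v H = 0"
    unfolding energy_form_def by (rule integral_eq_zero_AE) (use ae in \<open>eventually_elim, auto\<close>)
  then show ?thesis using diff[OF sq(5,6)] by simp
qed


subsection \<open>The radial solution\<close>

text \<open>The chain rule with inner function |x|^2, which unlike |x| is differentiable at the
  origin too.\<close>

lemma radial_C1:
  fixes V V' :: "real \<Rightarrow> real"
  assumes V: "\<And>x. (V has_field_derivative V' x) (at x)" and V': "continuous_on UNIV V'"
  defines "u \<equiv> \<lambda>p::plane. complex_of_real (V ((fst p)\<^sup>2 + (snd p)\<^sup>2))"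
  shows "C1 u"
    and "grad u = (\<lambda>p. (of_real (2 * fst p * V' ((fst p)\<^sup>2 + (snd p)\<^sup>2)), of_real (2 * snd p * V' ((fst p)\<^sup>2 + (snd p)\<^sup>2))))"
proof -
  let ?r = "\<lambda>p::plane. (fst p)\<^sup>2 + (snd p)\<^sup>2"
  have d: "(u has_derivative (\<lambda>h. fst h *\<^sub>R complex_of_real (2 * fst p * V' (?r p)) + snd h *\<^sub>R complex_of_real (2 * snd p * V' (?r p)))) (at p)" for p
  proof -
    have r: "(?r has_derivative (\<lambda>h. 2 * fst p * fst h + 2 * snd p * snd h)) (at p)"
      by (auto intro!: derivative_eq_intros)
    have "((\<lambda>p. V (?r p)) has_derivative (\<lambda>h. V' (?r p) * (2 * fst p * fst h + 2 * snd p * snd h))) (at p)"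
      using has_derivative_compose[OF r, of V "\<lambda>h. V' (?r p) * h"] V[of "?r p"] by (simp add: has_field_derivative_def)
    then have "((\<lambda>p. complex_of_real (V (?r p))) has_derivative (\<lambda>h. complex_of_real (V' (?r p) * (2 * fst p * fst h + 2 * snd p * snd h)))) (at p)"
      by (rule has_derivative_of_real)
    then show ?thesis unfolding u_def
      by (rule has_derivative_eq_rhs) (simp add: fun_eq_iff scaleR_conv_of_real algebra_simps)
  qed
  have c: "continuous_on UNIV (\<lambda>p. V' (?r p))"
    by (rule continuous_on_compose2[OF V']) (auto intro!: continuous_intros)
  have c1: "continuous_on UNIV (\<lambda>p. complex_of_real (2 * fst p * V' (?r p)))"
    and c2: "continuous_on UNIV (\<lambda>p. complex_of_real (2 * snd p * V' (?r p)))"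
    by (intro continuous_intros c)+
  show "C1 u" by (rule C1I(1)[OF d c1 c2])
  show "grad u = (\<lambda>p. (of_real (2 * fst p * V' (?r p)), of_real (2 * snd p * V' (?r p))))"
    by (rule C1I(2)[OF d c1 c2])
qed

text \<open>The two exceptional sets of the radial equation: the circle where \<open>V''\<close> is
  not a derivative, and the origin, where the indicator of the open interval (0, b)
  vanishes.\<close>

lemma AE_disk_circle: "AE x in disk_measure. norm x \<noteq> b \<and> x \<noteq> (0::plane)"
proof -
  have "negligible (sphere (0::plane) b \<union> {0})" by (intro negligible_Un negligible_sphere) simp
  then have "AE x in lebesgue. x \<notin> sphere (0::plane) b \<union> {0}"
    by (intro AE_not_in) (simp add: negligible_iff_null_sets)
  then have "AE x in disk_measure. x \<notin> sphere (0::plane) b \<union> {0}"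
    by (subst AE_restrict_space_iff) (auto simp: unit_disk_lmeasurable fmeasurableD)
  then show ?thesis by eventually_elim auto
qed

text \<open>A line parallel to an axis crosses the circle of radius b in at most two points; these
  are the exceptional sets in the Green formulas for the radial solution.\<close>

lemma finite_circle_chord: "finite {x::real. x\<^sup>2 + c = d}"
proof (rule finite_subset)
  show "{x. x\<^sup>2 + c = d} \<subseteq> {sqrt (d - c), - sqrt (d - c)}"
  proof
    fix x assume "x \<in> {x. x\<^sup>2 + c = d}"
    then have "d - c = x\<^sup>2" by auto
    then have "sqrt (d - c) = \<bar>x\<bar>" by simp
    then show "x \<in> {sqrt (d - c), - sqrt (d - c)}" by auto
  qed
qed simp

text \<open>The divergence theorem for the field \<phi> grad u, whose divergence is grad u . grad
  \<phi> + \<phi> times the Laplacian of u, that is the energy integrand almost everywhere. The flux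
  is constant along the circle because the normal derivative of V(|x|^2) at radius 1 is 2 V'
  1.\<close>

lemma radial_energy_C1:
  fixes V V' V'' :: "real \<Rightarrow> real"
  assumes V: "\<And>x. (V has_field_derivative V' x) (at x)" and V': "continuous_on UNIV V'"
    and V'': "\<And>x. x \<noteq> b\<^sup>2 \<Longrightarrow> (V' has_field_derivative V'' x) (at x)"
      "V'' \<in> borel_measurable borel" "\<And>x. 0 \<le> x \<Longrightarrow> x \<le> 1 \<Longrightarrow> \<bar>V'' x\<bar> \<le> K"
    and ode: "\<And>x. x < b\<^sup>2 \<Longrightarrow> 4 * (V' x + x * V'' x) = - \<gamma> * V x"
      "\<And>x. x > b\<^sup>2 \<Longrightarrow> V' x + x * V'' x = 0"
    and b: "0 < b"
    and q: "q \<in> borel_measurable disk_measure" "is_step_potential \<gamma> b q"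
    and \<phi>: "C1 \<phi>"
  defines "u \<equiv> \<lambda>p::plane. complex_of_real (V ((fst p)\<^sup>2 + (snd p)\<^sup>2))"
  shows "energy_form q u (grad u) \<phi> (grad \<phi>) = of_real (2 * V' 1) * (LINT t|angle_measure. \<phi> (cos t, sin t))"
proof -
  let ?r = "\<lambda>p::plane. (fst p)\<^sup>2 + (snd p)\<^sup>2"
  have u: "C1 u" unfolding u_def by (rule radial_C1[OF V V'])
  have g: "grad u = (\<lambda>p. (of_real (2 * fst p * V' (?r p)), of_real (2 * snd p * V' (?r p))))"
    unfolding u_def by (rule radial_C1[OF V V'])
  have cV': "continuous_on UNIV (\<lambda>p. V' (?r p))"
    by (rule continuous_on_compose2[OF V']) (auto intro!: continuous_intros)
  note c = C1D(1-3)[OF u] C1D(1-3)[OF \<phi>]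
  \<comment> \<open>m and n are the second partial derivatives of u in x and in y off the circle |p|
    = b; on the circle they are just Borel and bounded.\<close>
  define m where "m p = 2 * V' (?r p) + 4 * (fst p)\<^sup>2 * V'' (?r p)" for p :: plane
  define n where "n p = 2 * V' (?r p) + 4 * (snd p)\<^sup>2 * V'' (?r p)" for p :: plane
  have meas: "(\<lambda>p::plane. V'' (?r p)) \<in> borel_measurable borel"
    by (rule measurable_compose[OF borel_measurable_continuous_onI V''(2)]) (intro continuous_intros)
  have r1: "0 \<le> ?r p" "?r p \<le> 1" "(fst p)\<^sup>2 \<le> 1" "(snd p)\<^sup>2 \<le> 1" if "p \<in> unit_disk" for p
    using that mem_unit_disk[of "fst p" "snd p"] zero_le_power2[of "fst p"] zero_le_power2[of "snd p"]
    by (auto intro: order_trans[of _ "(fst p)\<^sup>2 + (snd p)\<^sup>2"])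
  have meas_mn: "m \<in> borel_measurable borel" "n \<in> borel_measurable borel"
  proof -
    have [measurable]: "(\<lambda>p. V' (?r p)) \<in> borel_measurable borel" "(\<lambda>p::plane. V'' (?r p)) \<in> borel_measurable borel"
      "(\<lambda>p::plane. fst p) \<in> borel_measurable borel" "(\<lambda>p::plane. snd p) \<in> borel_measurable borel"
      by (auto intro!: borel_measurable_continuous_onI cV' meas continuous_intros)
    show "m \<in> borel_measurable borel" "n \<in> borel_measurable borel" unfolding m_def[abs_def] n_def[abs_def] by measurable
  qed
  obtain BV where BV: "\<And>p. p \<in> unit_disk \<Longrightarrow> \<bar>V' (?r p)\<bar> \<le> BV"
    using continuous_bounded_disk[OF cV'] unfolding real_norm_def by blast
  have bound_aux: "\<bar>2 * V' (?r p) + 4 * s * V'' (?r p)\<bar> \<le> 2 * BV + 4 * K" if p: "p \<in> unit_disk" and s: "0 \<le> s" "s \<le> 1" for p s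
  proof -
    have "\<bar>s * V'' (?r p)\<bar> \<le> 1 * K"
      unfolding abs_mult using s V''(3)[OF r1(1,2)[OF p]] by (intro mult_mono) auto
    then show ?thesis using BV[OF p] by (simp add: abs_le_iff mult.assoc)
  qed
  have mn: "\<bar>m p\<bar> \<le> 2 * BV + 4 * K" "\<bar>n p\<bar> \<le> 2 * BV + 4 * K" if "p \<in> unit_disk" for p
    unfolding m_def n_def using bound_aux[OF that] r1[OF that] by auto
  let ?D1 = "\<lambda>p. of_real (m p) * \<phi> p + fst (grad u p) * fst (grad \<phi> p)"
  let ?D2 = "\<lambda>p. of_real (n p) * \<phi> p + snd (grad u p) * snd (grad \<phi> p)"
  have meas_D: "?D1 \<in> borel_measurable borel" "?D2 \<in> borel_measurable borel"
    using c[THEN borel_measurable_continuous_onI] meas_mn by auto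
  have bounded_D: "\<exists>B. \<forall>p\<in>unit_disk. norm (?D1 p) \<le> B" "\<exists>B. \<forall>p\<in>unit_disk. norm (?D2 p) \<le> B"
  proof -
    obtain Bp where Bp: "\<And>p. p \<in> unit_disk \<Longrightarrow> norm (\<phi> p) \<le> Bp"
      using continuous_bounded_disk[OF c(4)] by blast
    have 1: "continuous_on UNIV (\<lambda>p. fst (grad u p) * fst (grad \<phi> p))" "continuous_on UNIV (\<lambda>p. snd (grad u p) * snd (grad \<phi> p))"
      by (intro continuous_intros c)+
    obtain B1 where B1: "\<And>p. p \<in> unit_disk \<Longrightarrow> norm (fst (grad u p) * fst (grad \<phi> p)) \<le> B1"
      using continuous_bounded_disk[OF 1(1)] by blast
    obtain B2 where B2: "\<And>p. p \<in> unit_disk \<Longrightarrow> norm (snd (grad u p) * snd (grad \<phi> p)) \<le> B2"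
      using continuous_bounded_disk[OF 1(2)] by blast
    have p: "norm (of_real s * \<phi> p) \<le> (2 * BV + 4 * K) * Bp" if "p \<in> unit_disk" "\<bar>s\<bar> \<le> 2 * BV + 4 * K" for s p
      unfolding norm_mult using that Bp[of p] by (intro mult_mono) auto
    show "\<exists>B. \<forall>p\<in>unit_disk. norm (?D1 p) \<le> B"
      using p mn(1) B1 by (intro exI[of _ "(2 * BV + 4 * K) * Bp + B1"] ballI norm_triangle_le add_mono) auto
    show "\<exists>B. \<forall>p\<in>unit_disk. norm (?D2 p) \<le> B"
      using p mn(2) B2 by (intro exI[of _ "(2 * BV + 4 * K) * Bp + B2"] ballI norm_triangle_le add_mono) auto
  qed
  have slice: "((\<lambda>x. complex_of_real (2 * x * V' (x\<^sup>2 + s))) has_vector_derivative of_real (2 * V' (x\<^sup>2 + s) + 4 * x\<^sup>2 * V'' (x\<^sup>2 + s))) (at x)"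
    if "x\<^sup>2 + s \<noteq> b\<^sup>2" for x s
  proof -
    have r: "((\<lambda>x. x\<^sup>2 + s) has_field_derivative 2 * x) (at x)"
      by (auto intro!: derivative_eq_intros)
    have "((\<lambda>x. V' (x\<^sup>2 + s)) has_field_derivative V'' (x\<^sup>2 + s) * (2 * x)) (at x)"
      by (rule DERIV_chain2[OF V''(1)[OF that] r])
    from DERIV_mult[OF DERIV_cmult_Id[of 2] this]
    have "((\<lambda>x. 2 * x * V' (x\<^sup>2 + s)) has_field_derivative 2 * V' (x\<^sup>2 + s) + 4 * x\<^sup>2 * V'' (x\<^sup>2 + s)) (at x)"
      by (rule DERIV_cong) (simp add: power2_eq_square algebra_simps)
    then show ?thesis
      by (intro has_vector_derivative_of_real) (simp add: has_real_derivative_iff_has_vector_derivative)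
  qed
  obtain B1 where B1: "\<And>p. p \<in> unit_disk \<Longrightarrow> norm (?D1 p) \<le> B1" using bounded_D(1) by blast
  obtain B2 where B2: "\<And>p. p \<in> unit_disk \<Longrightarrow> norm (?D2 p) \<le> B2" using bounded_D(2) by blast
  have cF: "continuous_on UNIV (\<lambda>p. fst (grad u p) * \<phi> p)" "continuous_on UNIV (\<lambda>p. snd (grad u p) * \<phi> p)"
    by (intro continuous_intros c)+
  have 1: "(LINT p|disk_measure. ?D1 p) = (LINT t|angle_measure. of_real (cos t) * (fst (grad u (cos t, sin t)) * \<phi> (cos t, sin t)))"
  proof (rule green_disk_x[OF cF(1) meas_D(1) B1, of "\<lambda>y. {x. x\<^sup>2 + y\<^sup>2 = b\<^sup>2}"])
    fix x y :: real assume "x \<notin> {x. x\<^sup>2 + y\<^sup>2 = b\<^sup>2}"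
    then show "((\<lambda>x. fst (grad u (x, y)) * \<phi> (x, y)) has_vector_derivative
        of_real (m (x, y)) * \<phi> (x, y) + fst (grad u (x, y)) * fst (grad \<phi> (x, y))) (at x)"
      using has_vector_derivative_mult[OF slice[of x "y\<^sup>2"] C1D(4)[OF \<phi>, of y x]]
      by (simp add: g m_def add.commute)
  qed (auto simp: finite_circle_chord)
  have 2: "(LINT p|disk_measure. ?D2 p) = (LINT t|angle_measure. of_real (sin t) * (snd (grad u (cos t, sin t)) * \<phi> (cos t, sin t)))"
  proof (rule green_disk_y[OF cF(2) meas_D(2) B2, of "\<lambda>x. {y. y\<^sup>2 + x\<^sup>2 = b\<^sup>2}"])
    fix x y :: real assume "y \<notin> {y. y\<^sup>2 + x\<^sup>2 = b\<^sup>2}"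
    then show "((\<lambda>y. snd (grad u (x, y)) * \<phi> (x, y)) has_vector_derivative
        of_real (n (x, y)) * \<phi> (x, y) + snd (grad u (x, y)) * snd (grad \<phi> (x, y))) (at y)"
      using has_vector_derivative_mult[OF slice[of y "x\<^sup>2"] C1D(5)[OF \<phi>, of x y]]
      by (simp add: g n_def add.commute)
  qed (auto simp: finite_circle_chord)
  have i: "integrable disk_measure ?D1" "integrable disk_measure ?D2"
    using integrable_disk_bounded[OF meas_D(1) B1] integrable_disk_bounded[OF meas_D(2) B2] by auto
  have "energy_form q u (grad u) \<phi> (grad \<phi>) = (LINT p|disk_measure. ?D1 p + ?D2 p)"
    unfolding energy_form_def
  proof (rule integral_cong_AE)
    show "(\<lambda>x. fst (grad u x) * fst (grad \<phi> x) + snd (grad u x) * snd (grad \<phi> x) - complex_of_real (q x) * u x * \<phi> x) \<in> borel_measurable disk_measure"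
      using c[THEN borel_measurable_continuous_onI, THEN borel_measurable_disk] q(1) by auto
    show "(\<lambda>p. ?D1 p + ?D2 p) \<in> borel_measurable disk_measure"
      using meas_D[THEN borel_measurable_disk] by (rule borel_measurable_add)
    show "AE x in disk_measure. fst (grad u x) * fst (grad \<phi> x) + snd (grad u x) * snd (grad \<phi> x) - complex_of_real (q x) * u x * \<phi> x
        = ?D1 x + ?D2 x"
      using q(2)[unfolded is_step_potential_def] AE_disk_circle[of b]
    proof eventually_elim
      fix p assume qp: "q p = \<gamma> * indicator {0<..<b} (norm p)" and p: "norm p \<noteq> b \<and> p \<noteq> 0"
      have r: "?r p = (norm p)\<^sup>2" by (cases p) (simp add: norm_Pair)
      \<comment> \<open>The left side is the Laplacian of V(|p|^2), equal to m + n; the two cases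
        are the two sides of the circle.\<close>
      have "4 * (V' (?r p) + ?r p * V'' (?r p)) = - q p * V (?r p)"
      proof (cases "norm p < b")
        case True
        then have "?r p < b\<^sup>2" unfolding r by (intro power_strict_mono) auto
        then show ?thesis using ode(1)[of "?r p"] qp p True by simp
      next
        case False
        then have "?r p > b\<^sup>2" unfolding r using p b by (intro power_strict_mono) auto
        then show ?thesis using ode(2)[of "?r p"] qp False by simp
      qed
      then have "m p + n p = - q p * V (?r p)" by (simp add: m_def n_def algebra_simps)
      then have "of_real (m p) + of_real (n p) = - of_real (q p) * u p"
        unfolding u_def by (simp flip: of_real_add of_real_mult of_real_minus)
      then have "of_real (m p) * \<phi> p + of_real (n p) * \<phi> p = - of_real (q p) * u p * \<phi> p"
        by (simp flip: distrib_right)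
      then have e: "complex_of_real (q p) * u p * \<phi> p = - (of_real (m p) * \<phi> p + of_real (n p) * \<phi> p)"
        by simp
      show "fst (grad u p) * fst (grad \<phi> p) + snd (grad u p) * snd (grad \<phi> p) - complex_of_real (q p) * u p * \<phi> p = ?D1 p + ?D2 p"
        unfolding e by (simp add: algebra_simps)
    qed
  qed
  also have "\<dots> = (LINT p|disk_measure. ?D1 p) + (LINT p|disk_measure. ?D2 p)" using i by simp
  also have "\<dots> = (LINT t|angle_measure. of_real (cos t) * (fst (grad u (cos t, sin t)) * \<phi> (cos t, sin t)))
      + (LINT t|angle_measure. of_real (sin t) * (snd (grad u (cos t, sin t)) * \<phi> (cos t, sin t)))"
    unfolding 1 2 ..
  also have "\<dots> = (LINT t|angle_measure. of_real (cos t) * (fst (grad u (cos t, sin t)) * \<phi> (cos t, sin t))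
      + of_real (sin t) * (snd (grad u (cos t, sin t)) * \<phi> (cos t, sin t)))"
  proof (rule Bochner_Integration.integral_add[symmetric])
    have k: "continuous_on UNIV (\<lambda>t. f (cos t, sin t))" if "continuous_on UNIV f" for f :: "plane \<Rightarrow> complex"
      by (rule continuous_on_compose2[OF that]) (auto intro!: continuous_intros)
    have "continuous_on UNIV (\<lambda>t. complex_of_real (cos t) * (fst (grad u (cos t, sin t)) * \<phi> (cos t, sin t)))"
      "continuous_on UNIV (\<lambda>t. complex_of_real (sin t) * (snd (grad u (cos t, sin t)) * \<phi> (cos t, sin t)))"
      by (rule continuous_on_mult[OF _ k[OF cF(1)]], intro continuous_intros)
         (rule continuous_on_mult[OF _ k[OF cF(2)]], intro continuous_intros)
    from this[THEN continuous_on_subset[OF _ subset_UNIV], THEN continuous_imp_integrable_real]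
    show "integrable angle_measure (\<lambda>t. of_real (cos t) * (fst (grad u (cos t, sin t)) * \<phi> (cos t, sin t)))"
      "integrable angle_measure (\<lambda>t. of_real (sin t) * (snd (grad u (cos t, sin t)) * \<phi> (cos t, sin t)))" .
  qed
  \<comment> \<open>The gradient on the circle is 2 V' 1 times the unit normal (cos t, sin t), and
    the squares add up to 1.\<close>
  also have "\<dots> = (LINT t|angle_measure. of_real (2 * V' 1) * \<phi> (cos t, sin t))"
  proof (rule Bochner_Integration.integral_cong[OF refl])
    fix t :: real
    have "(cos t)\<^sup>2 + (sin t)\<^sup>2 = 1" by simp
    then have "complex_of_real (cos t) * of_real (cos t) + of_real (sin t) * of_real (sin t) = 1"
      by (simp flip: of_real_add of_real_mult add: power2_eq_square)
    then have "(complex_of_real (cos t) * of_real (cos t) + of_real (sin t) * of_real (sin t)) * (of_real (2 * V' 1) * \<phi> (cos t, sin t))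
       = of_real (2 * V' 1) * \<phi> (cos t, sin t)" by simp
    then show "of_real (cos t) * (fst (grad u (cos t, sin t)) * \<phi> (cos t, sin t)) + of_real (sin t) * (snd (grad u (cos t, sin t)) * \<phi> (cos t, sin t))
        = of_real (2 * V' 1) * \<phi> (cos t, sin t)"
      by (simp add: g algebra_simps)
  qed
  finally show ?thesis by simp
qed


subsection \<open>The Dirichlet-to-Neumann map on constants\<close>

text \<open>Both sides are continuous in the test function along its C1 approximation: the left one
  through square-mean convergence of function and gradient on the disk, the right one through that
  of the boundary values.\<close>

lemma energy_form_C1_limit:
  assumes u: "C1 u"
    and q: "q \<in> borel_measurable disk_measure" "AE x in disk_measure. \<bar>q x\<bar> \<le> B"
    and C1: "\<And>\<phi>. C1 \<phi> \<Longrightarrow> energy_form q u (grad u) \<phi> (grad \<phi>) = c * (LINT t|angle_measure. \<phi> (cos t, sin t))"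
    and v: "C1_limit v H h"
  shows "energy_form q u (grad u) v H = c * (LINT t|angle_measure. h t)"
proof -
  obtain \<phi> where a: "C1_approx \<phi> v H h" using v by (auto simp: C1_limit_def)
  have C: "C1 (\<phi> n)" for n using a by (auto simp: C1_approx_def)
  note sq = C1_approx_square_integrable[OF a]
  have su: "square_integrable disk_measure u" "square_integrable disk_measure (grad u)"
    using continuous_square_integrable_disk[OF C1D(1)[OF u]] continuous_square_integrable_disk[OF grad_continuous[OF u]] by auto
  have sv: "square_integrable disk_measure v" "square_integrable disk_measure H" "square_integrable angle_measure h"
    using v by (auto simp: C1_limit_def)
  have lim: "(\<lambda>n. LINT x|disk_measure. (norm (\<phi> n x - v x))\<^sup>2) \<longlonglongrightarrow> 0"
    "(\<lambda>n. LINT t|angle_measure. (norm (\<phi> n (cos t, sin t) - h t))\<^sup>2) \<longlonglongrightarrow> 0"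
    using a by (auto simp: C1_approx_def)
  have one: "square_integrable angle_measure (\<lambda>_. 1 :: complex)"
    using continuous_square_integrable_angle[of "\<lambda>_. 1 :: complex"] by simp
  have q': "(\<lambda>x. complex_of_real (q x)) \<in> borel_measurable disk_measure"
    "AE x in disk_measure. norm (complex_of_real (q x)) \<le> B"
    using q by auto
  have l1: "(\<lambda>n. LINT x|disk_measure. 1 * fst (grad u x) * fst (grad (\<phi> n) x)) \<longlonglongrightarrow> (LINT x|disk_measure. 1 * fst (grad u x) * fst (H x))"
    and l2: "(\<lambda>n. LINT x|disk_measure. 1 * snd (grad u x) * snd (grad (\<phi> n) x)) \<longlonglongrightarrow> (LINT x|disk_measure. 1 * snd (grad u x) * snd (H x))"
    by (intro continuous_weight_L2_tendsto continuous_on_const square_integrable_fst_snd su sv sq C1_approx_fst_snd[OF a sv(2)]; simp)+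
  have l3: "(\<lambda>n. LINT x|disk_measure. of_real (q x) * u x * \<phi> n x) \<longlonglongrightarrow> (LINT x|disk_measure. of_real (q x) * u x * v x)"
    by (rule L2_mult_tendsto[OF su(1) sv(1) su(1) sq(1) q' _ lim(1)]) simp
  have l4: "(\<lambda>n. LINT t|angle_measure. 1 * 1 * \<phi> n (cos t, sin t)) \<longlonglongrightarrow> (LINT t|angle_measure. 1 * 1 * h t)"
    by (rule L2_mult_tendsto[OF one sv(3) one sq(3) _ _ _ lim(2), of _ 1]) auto
  have "(\<lambda>n. energy_form q u (grad u) (\<phi> n) (grad (\<phi> n))) \<longlonglongrightarrow> energy_form q u (grad u) v H"
    unfolding energy_form_eq[OF su sq(1,2) q] energy_form_eq[OF su sv(1,2) q]
    by (intro tendsto_diff tendsto_add) (use l1 l2 l3 in simp_all)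
  moreover have "(\<lambda>n. energy_form q u (grad u) (\<phi> n) (grad (\<phi> n))) \<longlonglongrightarrow> c * (LINT t|angle_measure. h t)"
    unfolding C1[OF C] by (intro tendsto_mult tendsto_const) (use l4 in simp)
  ultimately show ?thesis by (rule LIMSEQ_unique)
qed

section \<open>Fourier modes and uniqueness of the normal derivative\<close>

lemma LINT_cis: "(LINT t|angle_measure. cis (of_int k * t)) = (if k = 0 then 2 * pi else 0)"
proof (cases "k = 0")
  case True
  then show ?thesis by (simp add: measure_restrict_space scaleR_conv_of_real)
next
  case False
  have c: "continuous_on {0..2 * pi} (\<lambda>t. cis (of_int k * t))" by (intro continuous_intros)
  have d: "((\<lambda>t. cis (of_int k * t) / (\<i> * of_int k)) has_vector_derivative cis (of_int k * t)) (at t within S)" for t S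
  proof -
    have "((\<lambda>z. exp (\<i> * of_int k * z) / (\<i> * of_int k)) has_field_derivative exp (\<i> * of_int k * of_real t)) (at (of_real t))"
      using False by (auto intro!: derivative_eq_intros)
    from has_vector_derivative_real_field[OF this] show ?thesis
      by (simp add: cis_conv_exp mult.assoc)
  qed
  have "((\<lambda>t. cis (of_int k * t)) has_integral (cis (of_int k * (2 * pi)) / (\<i> * of_int k) - cis (of_int k * 0) / (\<i> * of_int k))) {0..2 * pi}"
    by (intro fundamental_theorem_of_calculus d) auto
  moreover have "cis (of_int k * (2 * pi)) = 1"
    using cis_multiple_2pi[of "of_int k"] by (simp add: mult_ac)
  ultimately show ?thesis
    using False by (simp add: LINT_angle_eq_integral[OF c] integral_unique)
qed

lemma fourier_coeff_cis: "fourier_coeff (\<lambda>t. cis (of_int k * t)) n = (if n = k then 1 else 0)"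
proof -
  have "cis (of_int k * t) * cis (- (of_int n * t)) = cis (of_int (k - n) * t)" for t
    by (simp add: cis_mult algebra_simps)
  then show ?thesis using LINT_cis[of "k - n"] by (simp add: fourier_coeff_def)
qed

text \<open>The harmonic extension of the mode: z^k for k \<ge> 0 and the conjugate of z^(-k)
  otherwise. It provides test functions whose trace is a single Fourier mode.\<close>

lemma C1_trace_cis:
  obtains v where "C1 v" "\<And>t. v (cos t, sin t) = cis (of_int k * t)"
proof -
  define f where "f m p = (of_real (fst p) + \<i> * of_real (snd p)) ^ m" for m and p :: plane
  have f: "C1 (f m)" for m
  proof (rule C1I(1))
    fix p :: plane
    show "(f m has_derivative (\<lambda>h. fst h *\<^sub>R (of_nat m * (of_real (fst p) + \<i> * of_real (snd p)) ^ (m - 1))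
        + snd h *\<^sub>R (\<i> * of_nat m * (of_real (fst p) + \<i> * of_real (snd p)) ^ (m - 1)))) (at p)"
      unfolding f_def[abs_def]
      by (auto intro!: derivative_eq_intros simp: fun_eq_iff scaleR_conv_of_real algebra_simps)
  qed (intro continuous_intros)+
  have e: "f m (cos t, sin t) = cis (of_nat m * t)" for m t
  proof -
    have "complex_of_real (cos t) + \<i> * of_real (sin t) = cis t" by (simp add: complex_eq_iff)
    then show ?thesis using Complex.DeMoivre[of t m] by (simp only: f_def fst_conv snd_conv)
  qed
  show ?thesis
  proof (cases "k \<ge> 0")
    case True
    then show ?thesis using that[of "f (nat k)"] f e by simp
  next
    case False
    then show ?thesis using that[OF C1_cnj(1)[OF f[of "nat (- k)"]]] e by (simp add: cis_cnj)
  qed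
qed

lemma periodic_L2_cis: "periodic_L2 (\<lambda>t. cis (of_int k * t))"
  unfolding periodic_L2_def
proof
  show "\<forall>t. cis (of_int k * (t + 2 * pi)) = cis (of_int k * t)"
  proof
    fix t
    have "cis (of_int k * (t + 2 * pi)) = cis (of_int k * t) * cis (2 * pi * of_int k)"
      by (simp add: cis_mult algebra_simps)
    then show "cis (of_int k * (t + 2 * pi)) = cis (of_int k * t)" by (simp add: cis_multiple_2pi)
  qed
  show "square_integrable angle_measure (\<lambda>t. cis (of_int k * t))"
  proof (rule square_integrable_bounded[OF finite_measure_angle, of _ 1])
    have "continuous_on UNIV (\<lambda>t. cis (of_int k * t))" by (intro continuous_intros)
    then show "(\<lambda>t. cis (of_int k * t)) \<in> borel_measurable angle_measure"
      by (intro borel_measurable_angle borel_measurable_continuous_onI)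
  qed simp
qed

lemma has_sum_delta: "((\<lambda>m. f m * (if m = n then 1 else 0)) has_sum (f n :: complex)) UNIV"
  by (rule has_sum_finite_neutralI[of "{n}"]) auto

text \<open>Testing with one Fourier mode isolates one coefficient of the normal derivative as an
  energy, and energies do not depend on the chosen weak solution. Hence the definite description has
  exactly one candidate.\<close>

lemma DtN_eqI:
  assumes q: "q \<in> borel_measurable disk_measure" "AE x in disk_measure. 0 \<le> q x \<and> q x \<le> 1"
    and u: "weak_solution q g u G" and f: "normal_derivative q u G f"
  shows "DtN q g = f"
  unfolding DtN_def
proof (rule the_equality)
  show "\<exists>u G. weak_solution q g u G \<and> normal_derivative q u G f" using u f by blast
  fix f' assume "\<exists>u G. weak_solution q g u G \<and> normal_derivative q u G f'"
  then obtain u' G' where u': "weak_solution q g u' G'" and f': "normal_derivative q u' G' f'" by blast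
  show "f' = f"
  proof
    fix n
    \<comment> \<open>The pairing multiplies coefficient m of f by coefficient - m of the trace, so
      the mode with exponent - n singles out f n.\<close>
    obtain v where v: "C1 v" "\<And>t. v (cos t, sin t) = cis (of_int (- n) * t)" using C1_trace_cis by blast
    let ?h = "\<lambda>t. cis (of_int (- n) * t)"
    have t: "has_trace v (grad v) ?h"
      unfolding has_trace_iff using C1_limit_C1[OF v(1)] periodic_L2_cis[of "- n"] by (simp add: v(2))
    have fc: "fourier_coeff ?h (- m) = (if m = n then 1 else 0)" for m
      unfolding fourier_coeff_cis by auto
    have s: "((\<lambda>m. f m * fourier_coeff ?h (- m)) has_sum (energy_form q u G v (grad v) / (2 * pi))) UNIV"
      "((\<lambda>m. f' m * fourier_coeff ?h (- m)) has_sum (energy_form q u' G' v (grad v) / (2 * pi))) UNIV"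
      using f f' t unfolding normal_derivative_def by blast+
    have "f n = energy_form q u G v (grad v) / (2 * pi)" "f' n = energy_form q u' G' v (grad v) / (2 * pi)"
      using s[THEN infsumI] infsumI[OF has_sum_delta[of f n]] infsumI[OF has_sum_delta[of f' n]]
      unfolding fc by simp_all
    then show "f' n = f n" using weak_solution_unique[OF q u' u t] by simp
  qed
qed

lemma step_potential_bounds:
  assumes "is_step_potential \<gamma> b q" "0 \<le> \<gamma>" "\<gamma> \<le> 1"
  shows "AE x in disk_measure. 0 \<le> q x \<and> q x \<le> 1"
  using assms(1) unfolding is_step_potential_def
  by eventually_elim (use assms(2,3) in \<open>auto simp: indicator_def\<close>)

section \<open>The constant boundary value 1\<close>

lemma fourier_coeff_one: "fourier_coeff (\<lambda>_. 1) = (\<lambda>n. if n = 0 then 1 else 0)"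
  using fourier_coeff_cis[of 0] by auto

lemma periodic_L2_one: "periodic_L2 (\<lambda>_. 1)"
  using periodic_L2_cis[of 0] by simp

text \<open>At frequency 0 the weight is 1 for every exponent, so constants have the same norm in
  both boundary spaces.\<close>

lemma has_sum_sobolev_delta:
  "((\<lambda>n::int. (1 + (of_int n)\<^sup>2) powr \<alpha> * (cmod (if n = 0 then c else 0))\<^sup>2) has_sum (cmod c)\<^sup>2) UNIV"
  by (rule has_sum_finite_neutralI[of "{0}"]) auto

lemma sobolev_delta:
  "(\<lambda>n. if n = 0 then c else 0) \<in> sobolev_seq \<alpha>" "sobolev_norm \<alpha> (\<lambda>n. if n = 0 then c else 0) = cmod c"
  using has_sum_sobolev_delta[of \<alpha> c]
  by (auto simp: sobolev_seq_def sobolev_norm_def summable_on_def infsumI)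

text \<open>Besides the value of \<open>DtN\<close> the energy identity for C1 test functions is
  exported, because the comparison of two potentials tests each solution with the other, which is
  again C1. Here c = 2 V' 1.\<close>

lemma DtN_one:
  assumes q: "q \<in> borel_measurable disk_measure" "is_step_potential \<gamma> b q"
    and \<gamma>: "0 \<le> \<gamma>" "\<gamma> \<le> 1" and b: "0 < b" "b < 1"
  obtains U c where "C1 (\<lambda>p. complex_of_real (U p))" "continuous_on UNIV U"
    "\<And>p. p \<in> unit_disk \<Longrightarrow> 1 \<le> U p" "\<And>t. U (cos t, sin t) = 1"
    "\<And>\<phi>. C1 \<phi> \<Longrightarrow> energy_form q (\<lambda>p. of_real (U p)) (grad (\<lambda>p. of_real (U p))) \<phi> (grad \<phi>)
       = of_real c * (LINT t|angle_measure. \<phi> (cos t, sin t))"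
    "DtN q (\<lambda>_. 1) = (\<lambda>n. if n = 0 then of_real c else 0)"
proof -
  obtain V V' V'' K where V: "\<And>x. (V has_field_derivative V' x) (at x)" "continuous_on UNIV V'"
    "\<And>x. x \<noteq> b\<^sup>2 \<Longrightarrow> (V' has_field_derivative V'' x) (at x)"
    "V'' \<in> borel_measurable borel"
    "\<And>x. 0 \<le> x \<Longrightarrow> x \<le> 1 \<Longrightarrow> \<bar>V'' x\<bar> \<le> K"
    "\<And>x. x < b\<^sup>2 \<Longrightarrow> 4 * (V' x + x * V'' x) = - \<gamma> * V x"
    "\<And>x. x > b\<^sup>2 \<Longrightarrow> V' x + x * V'' x = 0"
    and V1: "V 1 = 1" "\<And>x. 0 \<le> x \<Longrightarrow> x \<le> 1 \<Longrightarrow> 1 \<le> V x"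
    by (rule radial_profile_exists[OF \<gamma> b]) (rule that)
  define U where "U p = V ((fst p)\<^sup>2 + (snd p)\<^sup>2)" for p :: plane
  let ?u = "\<lambda>p. complex_of_real (U p)"
  define c where "c = 2 * V' 1"
  have u: "C1 ?u" unfolding U_def by (rule radial_C1[OF V(1,2)])
  have cU: "continuous_on UNIV U"
  proof -
    have "continuous_on UNIV V" using V(1) by (meson DERIV_continuous_on has_field_derivative_at_within)
    then show ?thesis unfolding U_def[abs_def]
      by (rule continuous_on_compose2) (auto intro!: continuous_intros)
  qed
  have U1: "1 \<le> U p" if "p \<in> unit_disk" for p
    unfolding U_def using that mem_unit_disk[of "fst p" "snd p"] by (intro V1(2)) auto
  have Uc: "U (cos t, sin t) = 1" for t by (simp add: U_def V1)
  have e: "energy_form q ?u (grad ?u) \<phi> (grad \<phi>) = of_real c * (LINT t|angle_measure. \<phi> (cos t, sin t))" if "C1 \<phi>" for \<phi>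
    unfolding U_def c_def by (rule radial_energy_C1[OF V b(1) q that])
  have q01: "AE x in disk_measure. 0 \<le> q x \<and> q x \<le> 1" by (rule step_potential_bounds[OF q(2) \<gamma>])
  then have qB: "AE x in disk_measure. \<bar>q x\<bar> \<le> 1" by eventually_elim auto
  have el: "energy_form q ?u (grad ?u) v H = of_real c * (LINT t|angle_measure. h t)" if "has_trace v H h" for v H h
    using energy_form_C1_limit[OF u q(1) qB e] that by (auto simp: has_trace_iff)
  have tr: "has_trace ?u (grad ?u) (\<lambda>_. 1)"
    unfolding has_trace_iff using C1_limit_C1[OF u] periodic_L2_one by (simp add: Uc)
  have "weak_solution q (\<lambda>_. 1) ?u (grad ?u)"
    unfolding weak_solution_def using tr el by auto
  moreover have "normal_derivative q ?u (grad ?u) (\<lambda>n. if n = 0 then of_real c else 0)"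
    unfolding normal_derivative_def
  proof (intro conjI allI impI sobolev_delta)
    fix v H h assume "has_trace v H h"
    \<comment> \<open>The boundary integral of h is 2 pi times its zeroth Fourier coefficient, the
      only term left in the pairing.\<close>
    then have "energy_form q ?u (grad ?u) v H / (2 * pi) = of_real c * fourier_coeff h 0"
      using el by (simp add: fourier_coeff_def)
    then show "((\<lambda>n. (if n = 0 then of_real c else 0) * fourier_coeff h (- n)) has_sum (energy_form q ?u (grad ?u) v H / (2 * pi))) UNIV"
      by (intro has_sum_finite_neutralI[of "{0}"]) auto
  qed
  ultimately have D: "DtN q (\<lambda>_. 1) = (\<lambda>n. if n = 0 then of_real c else 0)"
    by (rule DtN_eqI[OF q(1) q01])
  show ?thesis by (intro that[of U c] u cU U1 Uc e D)
qed

text \<open>The constant 1 has norm 1 in the domain, so its image, again a constant, gives a lower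
  bound for the supremum.\<close>

lemma DtN_op_norm_ge:
  assumes "T (\<lambda>_. 1) = (\<lambda>n. if n = 0 then c else 0)"
  shows "ennreal (cmod c) \<le> DtN_op_norm T"
proof -
  have "(\<lambda>_. 1) \<in> H_half"
    unfolding H_half_def using periodic_L2_one sobolev_delta(1)[of 1] by (simp add: fourier_coeff_one)
  moreover have n: "sobolev_norm (1/2) (fourier_coeff (\<lambda>_. 1)) = 1"
    using sobolev_delta(2)[of "1/2" 1] by (simp add: fourier_coeff_one)
  ultimately have "ennreal (sobolev_norm (-1/2) (T (\<lambda>_. 1)) / sobolev_norm (1/2) (fourier_coeff (\<lambda>_. 1))) \<le> DtN_op_norm T"
    unfolding DtN_op_norm_def by (intro SUP_upper) auto
  then show ?thesis unfolding n assms sobolev_delta by simp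
qed

section \<open>Comparing two potentials on an annulus\<close>

text \<open>Half-open because the indicators of (0, b) and (0, a) with 0 < a \<le> b differ exactly
  on [a, b); a = 0 gives a full disk.\<close>

definition annulus :: "real \<Rightarrow> real \<Rightarrow> plane set" where
  "annulus a b = {x. a \<le> norm x \<and> norm x < b}"

text \<open>The left side is the area of the annulus, as a difference of the areas of two
  disks.\<close>

lemma annulus_integral_ge:
  assumes "0 \<le> a" "a \<le> b" "b \<le> 1"
    and W: "continuous_on UNIV W" "\<And>x. x \<in> unit_disk \<Longrightarrow> 1 \<le> W x"
  shows "pi * (b\<^sup>2 - a\<^sup>2) \<le> (LINT x|disk_measure. indicator (annulus a b) x * W x)"
proof -
  have ball: "measure lborel (ball (0::plane) r) = pi * r\<^sup>2" if "0 \<le> r" for r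
    using content_ball[OF that, of "0::plane"] by (simp add: unit_ball_vol_2 power2_eq_square)
  have A: "annulus a b = ball 0 b - ball 0 a" by (auto simp: annulus_def)
  have As: "annulus a b \<in> sets borel" unfolding A by simp
  have sub: "annulus a b \<subseteq> unit_disk" using assms by (auto simp: annulus_def unit_disk_def)
  have "measure lebesgue (annulus a b) = measure lebesgue (ball (0::plane) b) - measure lebesgue (ball (0::plane) a)"
    unfolding A using assms(2) by (intro measure_Diff) (use emeasure_bounded_finite[of "ball (0::plane) b"] in auto)
  then have m: "measure disk_measure (annulus a b) = pi * (b\<^sup>2 - a\<^sup>2)"
    using assms sub by (simp add: ball measure_restrict_space unit_disk_lmeasurable fmeasurableD right_diff_distrib)
  obtain B where B: "\<And>x. x \<in> unit_disk \<Longrightarrow> \<bar>W x\<bar> \<le> B"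
    using continuous_bounded_disk[OF W(1)] unfolding real_norm_def by blast
  have Wm: "W \<in> borel_measurable borel" by (intro borel_measurable_continuous_onI W)
  have i1: "integrable disk_measure (indicator (annulus a b) :: plane \<Rightarrow> real)"
    by (rule integrable_disk_bounded[of _ 1]) (use As in \<open>auto simp: indicator_def\<close>)
  have i2: "integrable disk_measure (\<lambda>x. indicator (annulus a b) x * W x)"
  proof (rule integrable_disk_bounded[of _ B])
    show "(\<lambda>x. indicator (annulus a b) x * W x) \<in> borel_measurable borel"
      using As Wm by measurable
    show "norm (indicator (annulus a b) x * W x) \<le> B" if "x \<in> unit_disk" for x
      using B[OF that] by (auto simp: indicator_def)
  qed
  have "pi * (b\<^sup>2 - a\<^sup>2) = (LINT x|disk_measure. indicator (annulus a b) x)"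
    using sub by (simp add: m[symmetric] Int_absorb2)
  also have "\<dots> \<le> (LINT x|disk_measure. indicator (annulus a b) x * W x)"
    by (intro integral_mono i1 i2) (use W(2) in \<open>auto simp: indicator_def\<close>)
  finally show ?thesis .
qed

text \<open>An identity of Alessandrini type: each solution is the test function for the other, the
  gradient parts of the two energies are equal by symmetry, and only the difference of the
  potentials remains. Writing this difference as s on an annulus covers a common radius (a = 0, s
  the difference of the heights) and a common height (s = \<gamma> or - \<gamma>) at once.\<close>

lemma DtN_op_norm_lower_bound:
  assumes q1: "q1 \<in> borel_measurable disk_measure" "is_step_potential \<gamma>1 b1 q1" "0 \<le> \<gamma>1" "\<gamma>1 \<le> 1" "0 < b1" "b1 < 1"
    and q2: "q2 \<in> borel_measurable disk_measure" "is_step_potential \<gamma>2 b2 q2" "0 \<le> \<gamma>2" "\<gamma>2 \<le> 1" "0 < b2" "b2 < 1"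
    and d: "AE x in disk_measure. q1 x - q2 x = s * indicator (annulus a b) x"
    and ab: "0 \<le> a" "a \<le> b" "b \<le> 1"
  shows "ennreal (\<bar>s\<bar> * (b\<^sup>2 - a\<^sup>2) / 2) \<le> DtN_op_norm (\<lambda>g n. DtN q1 g n - DtN q2 g n)"
proof -
  obtain U1 c1 where U1: "C1 (\<lambda>p. complex_of_real (U1 p))" "continuous_on UNIV U1"
    "\<And>p. p \<in> unit_disk \<Longrightarrow> 1 \<le> U1 p" "\<And>t. U1 (cos t, sin t) = 1"
    "\<And>\<phi>. C1 \<phi> \<Longrightarrow> energy_form q1 (\<lambda>p. of_real (U1 p)) (grad (\<lambda>p. of_real (U1 p))) \<phi> (grad \<phi>)
       = of_real c1 * (LINT t|angle_measure. \<phi> (cos t, sin t))"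
    "DtN q1 (\<lambda>_. 1) = (\<lambda>n. if n = 0 then of_real c1 else 0)"
    by (rule DtN_one[OF q1]) (rule that)
  obtain U2 c2 where U2: "C1 (\<lambda>p. complex_of_real (U2 p))" "continuous_on UNIV U2"
    "\<And>p. p \<in> unit_disk \<Longrightarrow> 1 \<le> U2 p" "\<And>t. U2 (cos t, sin t) = 1"
    "\<And>\<phi>. C1 \<phi> \<Longrightarrow> energy_form q2 (\<lambda>p. of_real (U2 p)) (grad (\<lambda>p. of_real (U2 p))) \<phi> (grad \<phi>)
       = of_real c2 * (LINT t|angle_measure. \<phi> (cos t, sin t))"
    "DtN q2 (\<lambda>_. 1) = (\<lambda>n. if n = 0 then of_real c2 else 0)"
    by (rule DtN_one[OF q2]) (rule that)
  let ?u1 = "\<lambda>p. complex_of_real (U1 p)" and ?u2 = "\<lambda>p. complex_of_real (U2 p)"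
  have l: "(LINT t|angle_measure. (1::complex)) = 2 * pi" using LINT_cis[of 0] by simp
  \<comment> \<open>The test function has trace 1, so its boundary integral is the length 2 pi of
    the circle.\<close>
  have e1: "energy_form q1 ?u1 (grad ?u1) ?u2 (grad ?u2) = of_real (2 * pi * c1)"
    using U1(5)[OF U2(1)] unfolding U2(4) of_real_1 l by (simp add: mult.commute)
  have e2: "energy_form q2 ?u2 (grad ?u2) ?u1 (grad ?u1) = of_real (2 * pi * c2)"
    using U2(5)[OF U1(1)] unfolding U1(4) of_real_1 l by (simp add: mult.commute)
  have bnd: "AE x in disk_measure. \<bar>q1 x\<bar> \<le> 1" "AE x in disk_measure. \<bar>q2 x\<bar> \<le> 1"
    using step_potential_bounds[OF q1(2-4)] step_potential_bounds[OF q2(2-4)] by (eventually_elim, auto)+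
  note s1 = continuous_square_integrable_disk[OF C1D(1)[OF U1(1)]] continuous_square_integrable_disk[OF grad_continuous[OF U1(1)]]
  note s2 = continuous_square_integrable_disk[OF C1D(1)[OF U2(1)]] continuous_square_integrable_disk[OF grad_continuous[OF U2(1)]]
  note i1 = energy_form_integrable[OF s1 s2 q1(1) bnd(1)] and i2 = energy_form_integrable[OF s2 s1 q2(1) bnd(2)]
  define J where "J = (LINT x|disk_measure. indicator (annulus a b) x * (U1 x * U2 x))"
  have "of_real (2 * pi * c2) - of_real (2 * pi * c1) =
     (LINT x|disk_measure. of_real (q1 x) * ?u1 x * ?u2 x) - (LINT x|disk_measure. of_real (q2 x) * ?u2 x * ?u1 x)"
    unfolding e1[symmetric] e2[symmetric] energy_form_eq[OF s1 s2 q1(1) bnd(1)] energy_form_eq[OF s2 s1 q2(1) bnd(2)]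
    by (simp add: mult.commute)
  also have "\<dots> = (LINT x|disk_measure. of_real (q1 x) * ?u1 x * ?u2 x - of_real (q2 x) * ?u2 x * ?u1 x)"
    using i1(3) i2(3) by simp
  also have "\<dots> = (LINT x|disk_measure. complex_of_real (s * (indicator (annulus a b) x * (U1 x * U2 x))))"
  proof (rule integral_cong_AE)
    have [measurable]: "U1 \<in> borel_measurable disk_measure" "U2 \<in> borel_measurable disk_measure"
      using U1(2) U2(2) by (auto intro!: borel_measurable_disk borel_measurable_continuous_onI)
    have [measurable]: "(indicator (annulus a b) :: plane \<Rightarrow> real) \<in> borel_measurable disk_measure"
      by (intro borel_measurable_disk) (auto simp: annulus_def)
    note [measurable] = q1(1) q2(1)
    show "(\<lambda>x. of_real (q1 x) * ?u1 x * ?u2 x - of_real (q2 x) * ?u2 x * ?u1 x) \<in> borel_measurable disk_measure"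
      "(\<lambda>x. complex_of_real (s * (indicator (annulus a b) x * (U1 x * U2 x)))) \<in> borel_measurable disk_measure"
      by measurable
    show "AE x in disk_measure. of_real (q1 x) * ?u1 x * ?u2 x - of_real (q2 x) * ?u2 x * ?u1 x
        = complex_of_real (s * (indicator (annulus a b) x * (U1 x * U2 x)))"
      using d
    proof eventually_elim
      fix x assume x: "q1 x - q2 x = s * indicator (annulus a b) x"
      have "of_real (q1 x) * ?u1 x * ?u2 x - of_real (q2 x) * ?u2 x * ?u1 x = complex_of_real ((q1 x - q2 x) * (U1 x * U2 x))"
        by (simp add: algebra_simps)
      then show "of_real (q1 x) * ?u1 x * ?u2 x - of_real (q2 x) * ?u2 x * ?u1 x
        = complex_of_real (s * (indicator (annulus a b) x * (U1 x * U2 x)))"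
        unfolding x by (simp add: mult.assoc)
    qed
  qed
  also have "\<dots> = of_real (s * J)" unfolding J_def by (simp only: integral_complex_of_real integral_mult_right_zero)
  finally have "2 * pi * c2 - 2 * pi * c1 = s * J"
    by (metis of_real_diff of_real_eq_iff)
  then have c: "2 * pi * \<bar>c1 - c2\<bar> = \<bar>s\<bar> * \<bar>J\<bar>"
    by (metis abs_minus_commute abs_mult abs_of_pos pi_gt_zero right_diff_distrib abs_numeral mult.assoc)
  have "pi * (b\<^sup>2 - a\<^sup>2) \<le> J"
    unfolding J_def
  proof (rule annulus_integral_ge[OF ab])
    show "continuous_on UNIV (\<lambda>x. U1 x * U2 x)" by (intro continuous_intros U1 U2)
    show "1 \<le> U1 x * U2 x" if "x \<in> unit_disk" for x
      using mult_mono[OF U1(3)[OF that] U2(3)[OF that]] U1(3)[OF that] by simp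
  qed
  then have "\<bar>s\<bar> * (pi * (b\<^sup>2 - a\<^sup>2)) \<le> 2 * pi * \<bar>c1 - c2\<bar>"
    unfolding c by (intro mult_left_mono) auto
  then have "pi * (\<bar>s\<bar> * (b\<^sup>2 - a\<^sup>2) / 2) \<le> pi * \<bar>c1 - c2\<bar>" by (simp add: algebra_simps)
  then have "\<bar>s\<bar> * (b\<^sup>2 - a\<^sup>2) / 2 \<le> \<bar>c1 - c2\<bar>" by (simp only: mult_le_cancel_left_pos[OF pi_gt_zero])
  then have "ennreal (\<bar>s\<bar> * (b\<^sup>2 - a\<^sup>2) / 2) \<le> ennreal (cmod (of_real c1 - of_real c2))"
    by (intro ennreal_leI) (simp flip: of_real_diff)
  also have "\<dots> \<le> DtN_op_norm (\<lambda>g n. DtN q1 g n - DtN q2 g n)"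
    by (rule DtN_op_norm_ge) (auto simp: U1(6) U2(6))
  finally show ?thesis .
qed

section \<open>From the lower bound to the two stability estimates\<close>

lemma ennreal_le_mult_of_le:
  assumes "ennreal y \<le> N" "0 \<le> K" "0 \<le> y" "x \<le> K * y"
  shows "ennreal x \<le> ennreal K * N"
proof -
  have "ennreal x \<le> ennreal K * ennreal y"
    using assms by (simp add: ennreal_leI flip: ennreal_mult)
  also have "\<dots> \<le> ennreal K * N" using assms by (intro mult_left_mono) auto
  finally show ?thesis .
qed

text \<open>Since a > 0 the annulus avoids the origin, where both potential formulas give 0, so the
  identity needs no further exceptional set.\<close>

lemma step_difference_annulus:
  assumes "is_step_potential \<gamma> a q1" "is_step_potential \<gamma> b q2" "0 < a" "a \<le> b"
  shows "AE x in disk_measure. q2 x - q1 x = \<gamma> * indicator (annulus a b) x"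
  using assms(1,2) unfolding is_step_potential_def
proof eventually_elim
  fix x :: plane
  assume "q1 x = \<gamma> * indicator {0<..<a} (norm x)" "q2 x = \<gamma> * indicator {0<..<b} (norm x)"
  then show "q2 x - q1 x = \<gamma> * indicator (annulus a b) x"
    using assms(3,4) by (auto simp: annulus_def indicator_def)
qed

text \<open>Factoring b^2 - a^2 = (b - a)(b + a) reduces the claim to 4 a^3 \<le> 15 (a + b), which
  follows from a^3 \<le> a.\<close>

lemma annulus_radius_bound:
  fixes a b \<gamma> :: real
  assumes "ennreal (\<gamma> * (b\<^sup>2 - a\<^sup>2) / 2) \<le> N" "0 < \<gamma>" "0 < a" "a \<le> b" "b < 1"
  shows "ennreal (b - a) \<le> ennreal (15 / (2 * \<gamma> * a ^ 3)) * N"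
proof (rule ennreal_le_mult_of_le[OF assms(1)])
  have "a\<^sup>2 \<le> b\<^sup>2" using assms by (intro power_mono) auto
  then show "0 \<le> \<gamma> * (b\<^sup>2 - a\<^sup>2) / 2" using assms by simp
  show "0 \<le> 15 / (2 * \<gamma> * a ^ 3)" using assms by simp
  have "a * a \<le> 1" using assms by (intro mult_le_one) auto
  then have "(a * a) * a \<le> 1 * a" using assms by (intro mult_right_mono) auto
  then have "4 * (a * a * a) \<le> 4 * a" by (intro mult_left_mono) auto
  also have "4 * a \<le> 15 * (b + a)" using assms by simp
  finally have "4 * (a * a * a) \<le> 15 * (b + a)" .
  then have "(b - a) * (4 * a ^ 3) \<le> (b - a) * (15 * (b + a))"
    using assms by (intro mult_left_mono) (auto simp: power3_eq_cube)
  then have "b - a \<le> (b - a) * (15 * (b + a)) / (4 * a ^ 3)"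
    using assms by (subst pos_le_divide_eq) auto
  also have "\<dots> = 15 / (2 * \<gamma> * a ^ 3) * (\<gamma> * (b\<^sup>2 - a\<^sup>2) / 2)"
    using assms by (simp add: field_simps power2_eq_square)
  finally show "b - a \<le> 15 / (2 * \<gamma> * a ^ 3) * (\<gamma> * (b\<^sup>2 - a\<^sup>2) / 2)" .
qed

theorem theorem4:
  shows "(\<forall>(b::real) q1 q2. 0 < b \<and> b < 1 \<and> q1 \<in> F_class b \<and> q2 \<in> F_class b \<longrightarrow>
            Linfty_norm (\<lambda>x. q1 x - q2 x)
              \<le> ennreal ((4.8765)\<^sup>2 / b ^ 4) * DtN_op_norm (\<lambda>g n. DtN q1 g n - DtN q2 g n)) \<and>
         (\<forall>(\<gamma>::real) (b1::real) (b2::real) q1 q2.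
            0 < \<gamma> \<and> \<gamma> \<le> 1 \<and> 0 < b1 \<and> b1 < 1 \<and> 0 < b2 \<and> b2 < 1 \<and>
            q1 \<in> G_class \<gamma> \<and> q2 \<in> G_class \<gamma> \<and>
            is_step_potential \<gamma> b1 q1 \<and> is_step_potential \<gamma> b2 q2 \<longrightarrow>
            ennreal \<bar>b1 - b2\<bar>
              \<le> ennreal (15 / (2 * \<gamma> * (min b1 b2) ^ 3)) * DtN_op_norm (\<lambda>g n. DtN q1 g n - DtN q2 g n))"
proof (intro conjI allI impI; elim conjE)
  fix b :: real and q1 q2
  assume b: "0 < b" "b < 1" and q: "q1 \<in> F_class b" "q2 \<in> F_class b"
  let ?N = "DtN_op_norm (\<lambda>g n. DtN q1 g n - DtN q2 g n)"
  obtain \<gamma>1 \<gamma>2 where g1: "is_step_potential \<gamma>1 b q1" "0 \<le> \<gamma>1" "\<gamma>1 \<le> 1"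
    and g2: "is_step_potential \<gamma>2 b q2" "0 \<le> \<gamma>2" "\<gamma>2 \<le> 1"
    using q by (auto simp: F_class_def)
  have m [measurable]: "q1 \<in> borel_measurable disk_measure" "q2 \<in> borel_measurable disk_measure"
    using q by (auto simp: F_class_def Linfty_def)
  \<comment> \<open>The origin lies in \<open>annulus 0 b\<close> but outside the open interval of
    the potential, hence it is discarded as a null set.\<close>
  have d: "AE x in disk_measure. q1 x - q2 x = (\<gamma>1 - \<gamma>2) * indicator (annulus 0 b) x"
    using g1(1)[unfolded is_step_potential_def] g2(1)[unfolded is_step_potential_def] AE_disk_circle[of b]
    by eventually_elim (auto simp: annulus_def indicator_def)
  have "Linfty_norm (\<lambda>x. q1 x - q2 x) \<le> ennreal \<bar>\<gamma>1 - \<gamma>2\<bar>"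
    unfolding Linfty_norm_def
  proof (rule esssup_I)
    show "(\<lambda>x. ennreal \<bar>q1 x - q2 x\<bar>) \<in> borel_measurable disk_measure" by measurable
    show "AE x in disk_measure. ennreal \<bar>q1 x - q2 x\<bar> \<le> ennreal \<bar>\<gamma>1 - \<gamma>2\<bar>"
      using d by eventually_elim (auto simp: indicator_def intro!: ennreal_leI)
  qed
  also have "\<dots> \<le> ennreal ((4.8765)\<^sup>2 / b ^ 4) * ?N"
  proof (rule ennreal_le_mult_of_le)
    show "ennreal (\<bar>\<gamma>1 - \<gamma>2\<bar> * (b\<^sup>2 - 0\<^sup>2) / 2) \<le> ?N"
      by (rule DtN_op_norm_lower_bound[OF m(1) g1 b m(2) g2 b d]) (use b in auto)
    have "b\<^sup>2 \<le> 1" using b by (simp add: power_le_one)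
    \<comment> \<open>After cancelling b^2 the stated constant only has to satisfy 2 b^2 \<le>
      (4.8765)^2, and the right side exceeds 23.\<close>
    then have "2 * b\<^sup>2 \<le> (4.8765)\<^sup>2" by (simp add: power2_eq_square)
    then have "1 \<le> (4.8765)\<^sup>2 / b ^ 4 * (b\<^sup>2 / 2)"
      using b by (simp add: field_simps power2_eq_square power4_eq_xxxx)
    then have "\<bar>\<gamma>1 - \<gamma>2\<bar> * 1 \<le> \<bar>\<gamma>1 - \<gamma>2\<bar> * ((4.8765)\<^sup>2 / b ^ 4 * (b\<^sup>2 / 2))"
      by (intro mult_left_mono) auto
    then show "\<bar>\<gamma>1 - \<gamma>2\<bar> \<le> (4.8765)\<^sup>2 / b ^ 4 * (\<bar>\<gamma>1 - \<gamma>2\<bar> * (b\<^sup>2 - 0\<^sup>2) / 2)"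
      by (simp add: mult_ac)
  qed auto
  finally show "Linfty_norm (\<lambda>x. q1 x - q2 x) \<le> ennreal ((4.8765)\<^sup>2 / b ^ 4) * ?N" .
next
  fix \<gamma> b1 b2 :: real and q1 q2
  assume g: "0 < \<gamma>" "\<gamma> \<le> 1" and b: "0 < b1" "b1 < 1" "0 < b2" "b2 < 1"
    and q: "q1 \<in> G_class \<gamma>" "q2 \<in> G_class \<gamma>"
    and s: "is_step_potential \<gamma> b1 q1" "is_step_potential \<gamma> b2 q2"
  let ?N = "DtN_op_norm (\<lambda>g n. DtN q1 g n - DtN q2 g n)"
  have m: "q1 \<in> borel_measurable disk_measure" "q2 \<in> borel_measurable disk_measure"
    using q by (auto simp: G_class_def Linfty_def)
  have g0: "0 \<le> \<gamma>" using g by simp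
  note lower = DtN_op_norm_lower_bound[OF m(1) s(1) g0 g(2) b(1,2) m(2) s(2) g0 g(2) b(3,4)]
  show "ennreal \<bar>b1 - b2\<bar> \<le> ennreal (15 / (2 * \<gamma> * (min b1 b2) ^ 3)) * ?N"
  proof (cases "b1 \<le> b2")
    case True
    \<comment> \<open>The potential with the larger radius is now q2, so the height on the annulus
      is - \<gamma>; the lower bound depends on its absolute value alone.\<close>
    have "AE x in disk_measure. q1 x - q2 x = - \<gamma> * indicator (annulus b1 b2) x"
      using step_difference_annulus[OF s b(1) True] by eventually_elim simp
    then have "ennreal (\<gamma> * (b2\<^sup>2 - b1\<^sup>2) / 2) \<le> ?N"
      using lower[of "- \<gamma>" b1 b2] b True g by simp
    from annulus_radius_bound[OF this g(1) b(1) True b(4)] show ?thesis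
      using True by (simp add: min_absorb1)
  next
    case False
    then have le: "b2 \<le> b1" by simp
    have "ennreal (\<gamma> * (b1\<^sup>2 - b2\<^sup>2) / 2) \<le> ?N"
      using lower[OF step_difference_annulus[OF s(2,1) b(3) le]] b le g by simp
    from annulus_radius_bound[OF this g(1) b(3) le b(2)] show ?thesis
      using le by (simp add: min_absorb2)
  qed
qed

end
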